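(* Suppose that the regularizers $r_t\equiv r$ are identical for all $t$ and that there exist constants $\bar\Delta,\sigma>0$ such that for all $0\le i<t$: (i) $\mathbb{E}\,\bar G_{i,t}^2\le(\hat\mu\bar\Delta|i-t|)^2$; (ii) $\mathbb{E}\|z_i\|^2\le\sigma^2$ and $\mathbb{E}\langle z_i,\bar x_t\rangle=0$. Suppose $\bar\Delta/\sigma<\sqrt{\hat\mu/(16L^3)}$. Set $\hat\eta_\star=(2\bar\Delta^2/(\hat\mu\sigma^2))^{1/3}$ and $\widehat{\mathcal{G}}=\hat\mu(\bar\Delta\sigma^2/\hat\mu^2)^{2/3}$, and let $D>0$ satisfy $D\ge\psi_0(x_0)-\psi_0^\star$. Run the averaged decision-dependent proximal stochastic gradient method in epochs $k=0,\dots,K-1$: set $X_0=x_0$ and let $X_{k+1}$ be the output (final average iterate) of the method started at $X_k$ and run for $T_k$ steps with constant step size $\eta_k$, where $$K=1+\left\lceil\log_2\left(\frac1L\left(\frac{\sigma^2\hat\mu}{\bar\Delta^2}\right)^{1/3}\right)\right\rceil,\qquad \eta_0=\frac1{2L},\qquad T_0=\left\lceil\frac{4L}{\hat\mu}\log\left(\frac{LD}{\sigma^2}\right)^+\right\rceil,$$ and, for all $k\ge1$, $$\eta_k=\frac{\eta_{k-1}+\hat\eta_\star}{2},\qquad T_k=\left\lceil\frac{2\log 12}{\hat\mu\eta_k}\right\rceil.$$ Then the time horizon $T=T_0+\cdots+T_{K-1}$ satisfies $$T\lesssim\frac{L}{\hat\mu}\log\left(\frac{LD}{\sigma^2}\right)^++\frac{\sigma^2}{\hat\mu\widehat{\mathcal{G}}}\le\frac{L}{\hat\mu}\log\left(\frac{D}{\widehat{\mathcal{G}}}\right)^++\frac{\sigma^2}{\hat\mu\widehat{\mathcal{G}}},$$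 and the tracking error satisfies $\mathbb{E}\left[\psi_T(X_K)-\psi_T^\star\right]\lesssim\widehat{\mathcal{G}}$.
   Context: Notation: $\mathbb{N}=\{0,1,2,\dots\}$; $\mathbb{R}^d$ carries the Euclidean inner product $\langle\cdot,\cdot\rangle$ and norm $\|\cdot\|$; $a^+=\max\{a,0\}$, and $\log(s)^+$ means $(\log s)^+$; $A\lesssim B$ means $A\le CB$ for an absolute numerical constant $C>0$ independent of all problem parameters. Problem family. For each $t\in\mathbb{N}$ and $x\in\mathbb{R}^d$, $f_{t,x}\colon\mathbb{R}^d\to\mathbb{R}$ is $\mu$-strongly convex and $C^1$-smooth with $L$-Lipschitz gradient, for common constants $\mu,L>0$; $\nabla f_{t,x}(u)$ denotes the gradient of $f_{t,x}(\cdot)$ at $u$. For each $t$, $r_t\colon\mathbb{R}^d\to\mathbb{R}\cup\{\infty\}$ is proper, closed, convex. Set $$\gamma:=\sup_{t\in\mathbb{N},\,u,x,y\in\mathbb{R}^d,\,x\ne y}\frac{\|\nabla f_{t,x}(u)-\nabla f_{t,y}(u)\|}{\|x-y\|},$$ and assume $\gamma<\mu/2$. Set $\bar\mu:=\mu-\gamma$ and $\hat\mu:=\mu-2\gamma>0$. The functions may be random (the problem may evolve stochastically), with these conditions holding for every outcome with deterministic $\mu,L,\gamma$. The temporal gradient drift is the random variable $\bar G_{i,t}:=\sup_{u,x\in\mathbb{R}^d}\|\nabla f_{i,x}(u)-\nabla f_{t,x}(u)\|$. Equilibria. For each $t$ there is a unique point $\bar x_t$ with $\bar x_t\in\operatorname{argmin}_{u\in\mathbb{R}^d}\{f_{t,\bar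 x_t}(u)+r_t(u)\}$. Set $\psi_t:=f_{t,\bar x_t}+r_t$ and $\psi_t^\star:=\min\psi_t=\psi_t(\bar x_t)$. Algorithm (averaged decision-dependent proximal stochastic gradient method). At time $t$, with current iterate $x_t$, current average $\hat x_t$ and step size $\eta\in(0,1/\bar\mu)$, a stochastic gradient $g_t$ (estimator of $\nabla f_{t,x_t}(x_t)$) is obtained and $$x_{t+1}=\operatorname{prox}_{\eta r_t}(x_t-\eta g_t)=\operatorname{argmin}_{u}\left\{r_t(u)+\tfrac{1}{2\eta}\|u-(x_t-\eta g_t)\|^2\right\},\qquad \hat x_{t+1}=\left(1-\tfrac{\hat\mu\eta}{2-\mu\eta}\right)\hat x_t+\tfrac{\hat\mu\eta}{2-\mu\eta}x_{t+1}.$$ The gradient noise is $z_t:=\nabla f_{t,x_t}(x_t)-g_t$. When run in epochs, time continues across epochs: with $t_k=T_0+\cdots+T_{k-1}$ (and $t_0=0$), epoch $k$ uses the times $t=t_k,\dots,t_k+T_k-1$ with constant step size $\eta_k$, is initialized by resetting both the iterate and the average to $x_{t_k}=\hat x_{t_k}=X_k$, and outputs as $X_{k+1}$ the average iterate obtained after its $T_k$ steps. Stochastic framework. There is a probability space $(\Omega,\mathcal{F},\mathbb{P})$ with filtration $(\mathcal{F}_t)_{t\ge0}$, $\mathcal{F}_0=\{\emptyset,\Omega\}$, such that for all $t\ge0$: $x_t,\bar x_t\colon\Omega\to\mathbb{R}^d$ are $\mathcal{F}_t$-measurable, and $z_t\colon\Omega\to\mathbb{R}^d$ is $\mathcal{F}_{t+1}$-measurable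 with $\mathbb{E}[z_t\mid\mathcal{F}_t]=0$. Consistently with $\mathcal{F}_0$ being trivial, the initial gap $\psi_0(x_0)-\psi_0^\star$ is deterministic. All quantities whose expectations are taken are understood to be random variables. *)

theory Defs
  imports "HOL-Probability.Probability"
begin

definition grad :: "('a::real_inner \<Rightarrow> real) \<Rightarrow> 'a \<Rightarrow> 'a" where
  "grad h u = (THE D. GDERIV h u :> D)"

definition strongly_convex :: "real \<Rightarrow> ('a::real_inner \<Rightarrow> real) \<Rightarrow> bool" where
  "strongly_convex \<mu> h \<longleftrightarrow>
     (\<forall>u v. \<forall>\<theta>\<in>{0..1}. h ((1 - \<theta>) *\<^sub>R u + \<theta> *\<^sub>R v)
        \<le> (1 - \<theta>) * h u + \<theta> * h v - \<mu> / 2 * \<theta> * (1 - \<theta>) * (norm (u - v))\<^sup>2)"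

(* Continuity of the gradient is part of the Lipschitz condition. *)
definition smooth_fun :: "real \<Rightarrow> ('a::real_inner \<Rightarrow> real) \<Rightarrow> bool" where
  "smooth_fun L h \<longleftrightarrow> (\<forall>u. GDERIV h u :> grad h u) \<and> L-lipschitz_on UNIV (grad h)"

(* The library's epigraph is for real-valued functions only. *)
definition ereal_epigraph :: "('a \<Rightarrow> ereal) \<Rightarrow> ('a \<times> real) set" where
  "ereal_epigraph h = {(u, a). h u \<le> ereal a}"

definition proper_closed_convex :: "('a::real_normed_vector \<Rightarrow> ereal) \<Rightarrow> bool" where
  "proper_closed_convex h \<longleftrightarrow>
     (\<forall>u. h u \<noteq> -\<infinity>) \<and> (\<exists>u. h u \<noteq> \<infinity>) \<and>
     closed (ereal_epigraph h) \<and> convex (ereal_epigraph h)"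

(* For a proper closed convex h the minimizer exists and is unique, so is_prox is the graph
   of the proximal operator of eta * h. *)
definition is_prox :: "real \<Rightarrow> ('a::real_normed_vector \<Rightarrow> ereal) \<Rightarrow> 'a \<Rightarrow> 'a \<Rightarrow> bool" where
  "is_prox \<eta> h w p \<longleftrightarrow>
     is_arg_min (\<lambda>u. h u + ereal (1 / (2 * \<eta>) * (norm (u - w))\<^sup>2)) (\<lambda>_. True) p"

(* In the next definitions phi x is the loss induced by the decision x (one time, one outcome)
   and rho is the regularizer. *)
definition objective :: "('a \<Rightarrow> 'a \<Rightarrow> real) \<Rightarrow> ('a \<Rightarrow> ereal) \<Rightarrow> 'a \<Rightarrow> 'a \<Rightarrow> ereal" where
  "objective \<phi> \<rho> x u = ereal (\<phi> x u) + \<rho> u"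

definition is_equilibrium :: "('a \<Rightarrow> 'a \<Rightarrow> real) \<Rightarrow> ('a \<Rightarrow> ereal) \<Rightarrow> 'a \<Rightarrow> bool" where
  "is_equilibrium \<phi> \<rho> p \<longleftrightarrow> is_arg_min (objective \<phi> \<rho> p) (\<lambda>_. True) p"

(* The gap psi u - psi_star for psi = phi p + rho. *)
definition gap :: "('a \<Rightarrow> 'a \<Rightarrow> real) \<Rightarrow> ('a \<Rightarrow> ereal) \<Rightarrow> 'a \<Rightarrow> 'a \<Rightarrow> ereal" where
  "gap \<phi> \<rho> p u = objective \<phi> \<rho> p u - (INF v. objective \<phi> \<rho> p v)"

(* The supremum also runs over all outcomes, so that it is deterministic; it is taken in the
   extended reals and may be infinite. *)
definition sensitivity ::
  "'w set \<Rightarrow> (nat \<Rightarrow> 'w \<Rightarrow> 'a \<Rightarrow> 'a::real_inner \<Rightarrow> real) \<Rightarrow> ereal" where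
  "sensitivity \<Omega> f =
     (SUP (\<omega>, t, u, x, y) \<in> {(\<omega>, t, u, x, y). \<omega> \<in> \<Omega> \<and> x \<noteq> y}.
        ereal (norm (grad (f t \<omega> x) u - grad (f t \<omega> y) u) / norm (x - y)))"

definition grad_drift ::
  "('a \<Rightarrow> 'a::real_inner \<Rightarrow> real) \<Rightarrow> ('a \<Rightarrow> 'a \<Rightarrow> real) \<Rightarrow> ennreal" where
  "grad_drift \<phi> \<phi>' = (SUP (u, x). ennreal (norm (grad (\<phi> x) u - grad (\<phi>' x) u)))"

(* The library's conditional expectation is real-valued; this is its coordinatewise version. *)
definition vec_cond_exp ::
  "'w measure \<Rightarrow> 'w measure \<Rightarrow> ('w \<Rightarrow> 'a::euclidean_space) \<Rightarrow> 'w \<Rightarrow> 'a" where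
  "vec_cond_exp M G Z \<omega> = (\<Sum>b\<in>Basis. real_cond_exp M G (\<lambda>\<omega>. Z \<omega> \<bullet> b) \<omega> *\<^sub>R b)"

(* n steps of the averaged method with step size eta, started at time s from the point x0, for
   one outcome: y j and yh j are the iterate and the average after j steps, reg t and g t the
   regularizer and the stochastic gradient at time t. *)
definition averaged_prox_run ::
  "real \<Rightarrow> real \<Rightarrow> real \<Rightarrow> nat \<Rightarrow> nat \<Rightarrow> (nat \<Rightarrow> 'a \<Rightarrow> ereal) \<Rightarrow> (nat \<Rightarrow> 'a) \<Rightarrow>
   'a \<Rightarrow> (nat \<Rightarrow> 'a) \<Rightarrow> (nat \<Rightarrow> 'a::real_normed_vector) \<Rightarrow> bool" where
  "averaged_prox_run \<mu> \<mu>hat \<eta> s n reg g x0 y yh \<longleftrightarrow>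
     y 0 = x0 \<and> yh 0 = x0 \<and>
     (\<forall>j<n. is_prox \<eta> (reg (s + j)) (y j - \<eta> *\<^sub>R g (s + j)) (y (Suc j)) \<and>
            yh (Suc j) = (1 - \<mu>hat * \<eta> / (2 - \<mu> * \<eta>)) *\<^sub>R yh j
                         + (\<mu>hat * \<eta> / (2 - \<mu> * \<eta>)) *\<^sub>R y (Suc j))"

(* The constant hidden in the relation "A is at most an absolute constant times B". It is a
   numeral because a constant bound by an existential quantifier inside a theorem could depend
   on the type variables of that theorem, that is on the dimension and on the sample space. *)
definition abs_const :: real where
  "abs_const = 1000"

end

theory Submission
  imports Defs
begin

text \<open>Fix a target time \<open>t\<close> and compare every earlier step with the equilibrium \<open>xbar t\<close> instead of the
  current one. The gradient mismatch at time \<open>i\<close> is then at most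
  \<open>G i t + \<gamma> * norm (x i - xbar t)\<close>, and the one-step proximal inequality shows that
  \<open>\<psi>\<^sub>t(average) - \<psi>\<^sub>t\<^sup>\<star> + \<mu>hat / 4 * (norm (x i - xbar t))\<^sup>2\<close> contracts by the factor
  \<open>1 - \<rho>\<close>, where \<open>\<rho> = \<mu>hat \<eta> / (2 - \<mu> \<eta>)\<close>, up to noise and drift. Equality of the
  regularizers lets the gap at time \<open>s\<close> control the gap at time \<open>t\<close>: the equilibria move by at most
  \<open>G s t / (\<mu> - \<gamma>)\<close>. Hence an epoch of length \<open>n\<close> maps an expected gap \<open>e\<close> to at most
  \<open>3 (1 - \<rho>)^n e + \<eta> \<sigma>\<^sup>2 + O(\<Delta>\<^sup>2 / (\<mu>hat \<eta>\<^sup>2))\<close>, and with the given schedule the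
  expected gap after epoch \<open>k\<close> stays below \<open>\<sigma>\<^sup>2 (14 \<eta> k + 32 \<eta>star)\<close>.\<close>

section \<open>Smooth and strongly convex functions\<close>

text \<open>The fixed target also settles the stochastic part: the noise enters to first order only
  through the pairing of \<open>z i\<close> with \<open>x i - xbar t\<close>. It has mean zero
  because \<open>x i\<close> is known before \<open>z i\<close> is drawn, while orthogonality to the
  later point \<open>xbar t\<close>, which may depend on \<open>z i\<close>, is a hypothesis. The
  estimates are therefore made for one outcome, with the noise kept as a term, and averaged
  afterwards. Averaging meets two obstacles. No second moment of the iterates is given, so it is
  propagated from the deterministic start before any inner product is integrated. And the drift is
  an extended number, finite only almost surely. The weight \<open>\<mu>hat / 4\<close> is dictated
  by \<open>\<rho>\<close>: with it both parts of the Lyapunov function contract by the same factor.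
  The constants 14 and 32 close the induction over the epochs: 14 is set by the first epoch, 32
  absorbs the drift.\<close>

lemma linear_part_nonneg:
  fixes A B :: real
  assumes "\<And>\<theta>. 0 < \<theta> \<Longrightarrow> \<theta> \<le> 1 \<Longrightarrow> 0 \<le> \<theta> * A + \<theta>\<^sup>2 * B"
  shows "0 \<le> A"
proof (rule ccontr)
  assume "\<not> 0 \<le> A"
  hence A: "A < 0" by simp
  \<comment> \<open>Small enough that the quadratic term takes at most half of the linear one. The
    lemma serves to read off first-order conditions from comparisons along segments, without
    directional derivatives.\<close>
  define \<theta> where "\<theta> = min 1 (- A / (2 * (\<bar>B\<bar> + 1)))"
  have \<theta>: "0 < \<theta>" "\<theta> \<le> 1" using A by (auto simp: \<theta>_def intro!: divide_neg_pos)
  have "\<theta> * (\<bar>B\<bar> + 1) \<le> - A / (2 * (\<bar>B\<bar> + 1)) * (\<bar>B\<bar> + 1)"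
    by (intro mult_right_mono) (auto simp: \<theta>_def)
  also have "\<dots> = - A / 2" by (simp add: field_simps)
  finally have "\<theta> * (\<bar>B\<bar> + 1) \<le> - A / 2" .
  moreover have "\<theta> * B \<le> \<theta> * (\<bar>B\<bar> + 1)" using \<theta> by (intro mult_left_mono) auto
  ultimately have "A + \<theta> * B < 0" using A by linarith
  hence "\<theta> * (A + \<theta> * B) < 0" using \<theta> by (simp add: mult_pos_neg)
  with assms[OF \<theta>] show False by (simp add: power2_eq_square algebra_simps)
qed

text \<open>Integrates the bound \<open>a + 2 * \<theta> * b\<close> on the derivative along the
  segment. Subtracting its antiderivative reduces this to monotonicity of a function of one real
  variable, so no integral occurs.\<close>

lemma segment_bound:
  fixes h :: "'a::real_inner \<Rightarrow> real"
  assumes der: "\<And>p. (h has_derivative (\<lambda>d. d \<bullet> E p)) (at p)"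
    and le: "\<And>\<theta>. 0 \<le> \<theta> \<Longrightarrow> \<theta> \<le> 1 \<Longrightarrow> (u - v) \<bullet> E (v + \<theta> *\<^sub>R (u - v)) \<le> a + 2 * \<theta> * b"
  shows "h u - h v \<le> a + b"
proof -
  define \<phi> where "\<phi> \<theta> = h (v + \<theta> *\<^sub>R (u - v)) - \<theta> * a - \<theta>\<^sup>2 * b" for \<theta>
  have D: "(\<phi> has_real_derivative ((u - v) \<bullet> E (v + \<theta> *\<^sub>R (u - v)) - a - 2 * \<theta> * b)) (at \<theta>)" for \<theta>
  proof -
    have "((\<lambda>\<theta>. v + \<theta> *\<^sub>R (u - v)) has_derivative (\<lambda>x. x *\<^sub>R (u - v))) (at \<theta>)"
      by (auto intro!: derivative_eq_intros)
    from has_derivative_compose[OF this der]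
    have "((\<lambda>\<theta>. h (v + \<theta> *\<^sub>R (u - v))) has_real_derivative
        (u - v) \<bullet> E (v + \<theta> *\<^sub>R (u - v))) (at \<theta>)"
      by (simp add: has_field_derivative_def mult_ac mult_commute_abs)
    then show ?thesis unfolding \<phi>_def
      by (auto intro!: derivative_eq_intros)
  qed
  have "\<phi> 1 \<le> \<phi> 0"
  proof (rule DERIV_nonpos_imp_nonincreasing[of 0 1 \<phi>])
    fix \<theta> :: real assume "0 \<le> \<theta>" "\<theta> \<le> 1"
    with le[OF this] D[of \<theta>] show "\<exists>y. DERIV \<phi> \<theta> :> y \<and> y \<le> 0"
      by (intro exI[of _ "(u - v) \<bullet> E (v + \<theta> *\<^sub>R (u - v)) - a - 2 * \<theta> * b"]) auto
  qed simp
  thus ?thesis by (simp add: \<phi>_def)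
qed

lemma smooth_fun_has_derivative:
  "smooth_fun L h \<Longrightarrow> (h has_derivative (\<lambda>d. d \<bullet> grad h p)) (at p)"
  by (simp add: smooth_fun_def gderiv_def)

lemma smooth_fun_grad_dist:
  "smooth_fun L h \<Longrightarrow> norm (grad h p - grad h q) \<le> L * norm (p - q)"
  unfolding smooth_fun_def lipschitz_on_def dist_norm by blast

lemma smooth_fun_upper:
  assumes h: "smooth_fun L h"
  shows "h u \<le> h v + (u - v) \<bullet> grad h v + L / 2 * (norm (u - v))\<^sup>2"
proof -
  have "h u - h v \<le> (u - v) \<bullet> grad h v + L / 2 * (norm (u - v))\<^sup>2"
  proof (rule segment_bound[OF smooth_fun_has_derivative[OF h]])
    fix \<theta> :: real assume \<theta>: "0 \<le> \<theta>" "\<theta> \<le> 1"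
    let ?p = "v + \<theta> *\<^sub>R (u - v)"
    have "(u - v) \<bullet> (grad h ?p - grad h v) \<le> norm (u - v) * norm (grad h ?p - grad h v)"
      by (rule norm_cauchy_schwarz)
    also have "\<dots> \<le> norm (u - v) * (L * norm (?p - v))"
      by (intro mult_left_mono smooth_fun_grad_dist[OF h]) auto
    finally show "(u - v) \<bullet> grad h ?p \<le> (u - v) \<bullet> grad h v + 2 * \<theta> * (L / 2 * (norm (u - v))\<^sup>2)"
      using \<theta> by (simp add: inner_diff_right power2_eq_square mult_ac)
  qed
  thus ?thesis by simp
qed

lemma smooth_fun_lower:
  assumes h: "smooth_fun L h"
  shows "h v + (u - v) \<bullet> grad h v - L / 2 * (norm (u - v))\<^sup>2 \<le> h u"
proof -
  have d: "((\<lambda>p. - h p) has_derivative (\<lambda>d. d \<bullet> (- grad h p))) (at p)" for p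
    using has_derivative_minus[OF smooth_fun_has_derivative[OF h, of p]] by simp
  have "- h u - (- h v) \<le> - ((u - v) \<bullet> grad h v) + L / 2 * (norm (u - v))\<^sup>2"
  proof (rule segment_bound[OF d])
    fix \<theta> :: real assume \<theta>: "0 \<le> \<theta>" "\<theta> \<le> 1"
    let ?p = "v + \<theta> *\<^sub>R (u - v)"
    have "(u - v) \<bullet> (grad h v - grad h ?p) \<le> norm (u - v) * norm (grad h v - grad h ?p)"
      by (rule norm_cauchy_schwarz)
    also have "\<dots> \<le> norm (u - v) * (L * norm (v - ?p))"
      by (intro mult_left_mono smooth_fun_grad_dist[OF h]) auto
    finally show "(u - v) \<bullet> (- grad h ?p) \<le> - ((u - v) \<bullet> grad h v) + 2 * \<theta> * (L / 2 * (norm (u - v))\<^sup>2)"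
      using \<theta> by (simp add: inner_diff_right power2_eq_square mult_ac)
  qed
  thus ?thesis by simp
qed

text \<open>The device by which losses of different times or decisions are compared. The assumptions
  control differences of gradients, not of values, so only increments can be compared.\<close>

lemma smooth_fun_diff_bound:
  assumes h1: "smooth_fun L h1" and h2: "smooth_fun L h2"
    and le: "\<And>p. norm (grad h1 p - grad h2 p) \<le> C"
  shows "(h1 u - h1 v) - (h2 u - h2 v) \<le> C * norm (u - v)"
proof -
  have d: "((\<lambda>p. h1 p - h2 p) has_derivative (\<lambda>d. d \<bullet> (grad h1 p - grad h2 p))) (at p)" for p
    using has_derivative_diff[OF smooth_fun_has_derivative[OF h1, of p] smooth_fun_has_derivative[OF h2, of p]]
    by (simp add: inner_diff_right)
  have "(h1 u - h2 u) - (h1 v - h2 v) \<le> C * norm (u - v) + 0"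
  proof (rule segment_bound[OF d])
    fix \<theta> :: real
    let ?p = "v + \<theta> *\<^sub>R (u - v)"
    have "(u - v) \<bullet> (grad h1 ?p - grad h2 ?p) \<le> norm (u - v) * norm (grad h1 ?p - grad h2 ?p)"
      by (rule norm_cauchy_schwarz)
    also have "\<dots> \<le> norm (u - v) * C" by (intro mult_left_mono le) auto
    finally show "(u - v) \<bullet> (grad h1 ?p - grad h2 ?p) \<le> C * norm (u - v) + 2 * \<theta> * 0"
      by (simp add: mult_ac)
  qed
  thus ?thesis by simp
qed

lemma strongly_convexD:
  assumes "strongly_convex \<mu> h" "0 \<le> \<theta>" "\<theta> \<le> 1"
  shows "h (v + \<theta> *\<^sub>R (u - v)) \<le> (1 - \<theta>) * h v + \<theta> * h u - \<mu> / 2 * \<theta> * (1 - \<theta>) * (norm (u - v))\<^sup>2"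
proof -
  have "v + \<theta> *\<^sub>R (u - v) = (1 - \<theta>) *\<^sub>R v + \<theta> *\<^sub>R u" by (simp add: algebra_simps)
  moreover have "h ((1 - \<theta>) *\<^sub>R v + \<theta> *\<^sub>R u)
      \<le> (1 - \<theta>) * h v + \<theta> * h u - \<mu> / 2 * \<theta> * (1 - \<theta>) * (norm (v - u))\<^sup>2"
    using assms unfolding strongly_convex_def by auto
  ultimately show ?thesis by (simp add: norm_minus_commute)
qed

text \<open>At \<open>v + \<theta> *\<^sub>R (u - v)\<close> the convexity inequality meets the
  quadratic lower bound from smoothness; the part linear in \<open>\<theta>\<close> is the
  claim.\<close>

lemma strongly_convex_lower:
  assumes sc: "strongly_convex \<mu> h" and sm: "smooth_fun L h"
  shows "h v + (u - v) \<bullet> grad h v + \<mu> / 2 * (norm (u - v))\<^sup>2 \<le> h u"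
proof -
  let ?n = "(norm (u - v))\<^sup>2"
  have "0 \<le> h u - h v - (u - v) \<bullet> grad h v - \<mu> / 2 * ?n"
  proof (rule linear_part_nonneg)
    fix \<theta> :: real assume \<theta>: "0 < \<theta>" "\<theta> \<le> 1"
    have "h v + \<theta> * ((u - v) \<bullet> grad h v) - L / 2 * (\<theta>\<^sup>2 * ?n) \<le> h (v + \<theta> *\<^sub>R (u - v))"
      using smooth_fun_lower[OF sm, of v "v + \<theta> *\<^sub>R (u - v)"] \<theta> by (simp add: power_mult_distrib)
    also have "\<dots> \<le> (1 - \<theta>) * h v + \<theta> * h u - \<mu> / 2 * \<theta> * (1 - \<theta>) * ?n"
      using strongly_convexD[OF sc, of \<theta>] \<theta> by simp
    finally show "0 \<le> \<theta> * (h u - h v - (u - v) \<bullet> grad h v - \<mu> / 2 * ?n)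
        + \<theta>\<^sup>2 * (L / 2 * ?n + \<mu> / 2 * ?n)"
      by (simp add: field_simps power2_eq_square)
  qed
  thus ?thesis by simp
qed

text \<open>The two quadratic bounds sandwich \<open>h\<close> along any nonzero direction; a basis
  vector supplies one of length 1.\<close>

lemma strong_convexity_le_smoothness:
  fixes h :: "'a::euclidean_space \<Rightarrow> real"
  assumes sc: "strongly_convex \<mu> h" and sm: "smooth_fun L h"
  shows "\<mu> \<le> L"
proof -
  obtain b :: 'a where b: "b \<in> Basis" using nonempty_Basis by blast
  have "\<mu> / 2 * (norm (b - 0))\<^sup>2 \<le> L / 2 * (norm (b - 0))\<^sup>2"
    using strongly_convex_lower[OF sc sm, of 0 b] smooth_fun_upper[OF sm, of b 0] by linarith
  thus ?thesis using b by simp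
qed

section \<open>The proximal step\<close>

lemma power2_norm_add:
  fixes a b :: "'a::real_inner"
  shows "(norm (a + b))\<^sup>2 = (norm a)\<^sup>2 + 2 * (a \<bullet> b) + (norm b)\<^sup>2"
  unfolding power2_norm_eq_inner inner_add_left inner_add_right inner_commute[of b a] by simp

lemma convex_epigraph_segment:
  assumes h: "proper_closed_convex h" and u: "h u \<noteq> \<infinity>" and v: "h v \<noteq> \<infinity>"
    and \<theta>: "0 \<le> \<theta>" "\<theta> \<le> 1"
  shows "h (v + \<theta> *\<^sub>R (u - v)) \<noteq> \<infinity>"
    and "real_of_ereal (h (v + \<theta> *\<^sub>R (u - v)))
      \<le> (1 - \<theta>) * real_of_ereal (h v) + \<theta> * real_of_ereal (h u)"
proof -
  have fin: "h p \<noteq> - \<infinity>" for p using h by (simp add: proper_closed_convex_def)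
  have cv: "convex (ereal_epigraph h)" using h by (simp add: proper_closed_convex_def)
  have mem: "(v, real_of_ereal (h v)) \<in> ereal_epigraph h" "(u, real_of_ereal (h u)) \<in> ereal_epigraph h"
    using u v fin[of u] fin[of v]
    by (cases "h u"; cases "h v"; simp add: ereal_epigraph_def)+
  have "(1 - \<theta>) *\<^sub>R (v, real_of_ereal (h v)) + \<theta> *\<^sub>R (u, real_of_ereal (h u)) \<in> ereal_epigraph h"
    using convexD[OF cv mem, of "1 - \<theta>" \<theta>] \<theta> by simp
  hence "h ((1 - \<theta>) *\<^sub>R v + \<theta> *\<^sub>R u)
      \<le> ereal ((1 - \<theta>) * real_of_ereal (h v) + \<theta> * real_of_ereal (h u))"
    by (simp add: ereal_epigraph_def)
  moreover have "(1 - \<theta>) *\<^sub>R v + \<theta> *\<^sub>R u = v + \<theta> *\<^sub>R (u - v)" by (simp add: algebra_simps)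
  ultimately have le: "h (v + \<theta> *\<^sub>R (u - v))
      \<le> ereal ((1 - \<theta>) * real_of_ereal (h v) + \<theta> * real_of_ereal (h u))" by simp
  thus "h (v + \<theta> *\<^sub>R (u - v)) \<noteq> \<infinity>" by auto
  with le fin[of "v + \<theta> *\<^sub>R (u - v)"] show "real_of_ereal (h (v + \<theta> *\<^sub>R (u - v)))
      \<le> (1 - \<theta>) * real_of_ereal (h v) + \<theta> * real_of_ereal (h u)"
    by (cases "h (v + \<theta> *\<^sub>R (u - v))") auto
qed

text \<open>Passage from extended to real arithmetic: one point \<open>v\<close> with a finite value
  forces the minimum to be finite, after which \<open>real_of_ereal\<close> loses nothing.\<close>

lemma arg_min_add_real:
  fixes h :: "'a \<Rightarrow> ereal" and c :: "'a \<Rightarrow> real"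
  assumes h: "\<And>u. h u \<noteq> - \<infinity>" "h v \<noteq> \<infinity>"
    and min: "is_arg_min (\<lambda>u. h u + ereal (c u)) (\<lambda>_. True) p"
  shows "h p \<noteq> \<infinity>"
    and "h u \<noteq> \<infinity> \<Longrightarrow> real_of_ereal (h p) + c p \<le> real_of_ereal (h u) + c u"
proof -
  have le: "h p + ereal (c p) \<le> h q + ereal (c q)" for q
    using min by (simp add: is_arg_min_linorder)
  show p: "h p \<noteq> \<infinity>" using le[of v] h(2) h(1)[of v] by auto
  show "real_of_ereal (h p) + c p \<le> real_of_ereal (h u) + c u" if "h u \<noteq> \<infinity>"
    using le[of u] that p h(1)[of p] h(1)[of u] by (cases "h p"; cases "h u") auto
qed

lemma prox_finite:
  assumes h: "proper_closed_convex h" and p: "is_prox \<eta> h w p"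
  shows "h p \<noteq> \<infinity>"
proof -
  obtain v where v: "h v \<noteq> \<infinity>" and "\<And>u. h u \<noteq> - \<infinity>"
    using h by (auto simp: proper_closed_convex_def)
  thus ?thesis using arg_min_add_real(1)[OF _ v p[unfolded is_prox_def]] by simp
qed

text \<open>Strong convexity of the proximal objective at its minimizer: \<open>p\<close> is
  compared with \<open>p + \<theta> *\<^sub>R (u - p)\<close>, and the part linear in
  \<open>\<theta>\<close> is kept.\<close>

lemma prox_three_point:
  fixes h :: "'a::real_inner \<Rightarrow> ereal"
  assumes h: "proper_closed_convex h" and \<eta>: "0 < \<eta>" and p: "is_prox \<eta> h w p" and u: "h u \<noteq> \<infinity>"
  shows "2 * \<eta> * (real_of_ereal (h p) - real_of_ereal (h u))
      \<le> (norm (u - w))\<^sup>2 - (norm (p - w))\<^sup>2 - (norm (u - p))\<^sup>2"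
proof -
  let ?r = "\<lambda>u. real_of_ereal (h u)"
  have pf: "h p \<noteq> \<infinity>" by (rule prox_finite[OF h p])
  define I where "I = (p - w) \<bullet> (u - p)"
  have "0 \<le> 2 * \<eta> * (?r u - ?r p) + 2 * I"
  proof (rule linear_part_nonneg)
    fix \<theta> :: real assume \<theta>: "0 < \<theta>" "\<theta> \<le> 1"
    let ?q = "p + \<theta> *\<^sub>R (u - p)"
    have q: "h ?q \<noteq> \<infinity>" "?r ?q \<le> (1 - \<theta>) * ?r p + \<theta> * ?r u"
      using convex_epigraph_segment[OF h u pf, of \<theta>] \<theta> by auto
    have "?r p + 1 / (2 * \<eta>) * (norm (p - w))\<^sup>2 \<le> ?r ?q + 1 / (2 * \<eta>) * (norm (?q - w))\<^sup>2"
      using h p u unfolding is_prox_def proper_closed_convex_def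
      by (intro arg_min_add_real(2)[where v = u and h = h] q(1)) auto
    hence "2 * \<eta> * (?r p + 1 / (2 * \<eta>) * (norm (p - w))\<^sup>2)
        \<le> 2 * \<eta> * (?r ?q + 1 / (2 * \<eta>) * (norm (?q - w))\<^sup>2)"
      using \<eta> by (intro mult_left_mono) auto
    hence 1: "2 * \<eta> * ?r p + (norm (p - w))\<^sup>2 \<le> 2 * \<eta> * ?r ?q + (norm (?q - w))\<^sup>2"
      using \<eta> by (simp add: distrib_left)
    have 2: "2 * \<eta> * ?r ?q \<le> 2 * \<eta> * ((1 - \<theta>) * ?r p + \<theta> * ?r u)"
      using \<eta> q(2) by (intro mult_left_mono) auto
    have "(norm (?q - w))\<^sup>2 = (norm (p - w))\<^sup>2 + 2 * (\<theta> * I) + \<theta>\<^sup>2 * (norm (u - p))\<^sup>2"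
      unfolding diff_add_eq[symmetric] power2_norm_add I_def by (simp add: power_mult_distrib)
    with 1 2 show "0 \<le> \<theta> * (2 * \<eta> * (?r u - ?r p) + 2 * I)
        + \<theta>\<^sup>2 * (norm (u - p))\<^sup>2"
      by (simp add: left_diff_distrib right_diff_distrib distrib_left distrib_right mult_ac)
  qed
  moreover have "(norm (u - w))\<^sup>2 = (norm (p - w))\<^sup>2 + 2 * I + (norm (u - p))\<^sup>2"
    using power2_norm_add[of "p - w" "u - p"] by (simp add: I_def)
  ultimately show ?thesis by (simp add: right_diff_distrib)
qed

section \<open>Equilibria and epochs for one outcome\<close>

text \<open>The bound is a real number, whereas \<open>grad_drift\<close> is an extended one that
  may be infinite on a null set of outcomes.\<close>

definition bounded_drift :: "('a \<Rightarrow> 'a::real_inner \<Rightarrow> real) \<Rightarrow> ('a \<Rightarrow> 'a \<Rightarrow> real) \<Rightarrow> real \<Rightarrow> bool" where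
  "bounded_drift \<phi> \<phi>' G \<longleftrightarrow> (\<forall>p u. norm (grad (\<phi> p) u - grad (\<phi>' p) u) \<le> G)"

lemma grad_drift_finite:
  assumes "grad_drift \<phi> \<phi>' \<noteq> \<infinity>"
  shows "bounded_drift \<phi> \<phi>' (enn2real (grad_drift \<phi> \<phi>'))"
  unfolding bounded_drift_def
proof (intro allI)
  fix p u
  have "ennreal (norm (grad (\<phi> p) u - grad (\<phi>' p) u)) \<le> grad_drift \<phi> \<phi>'"
    unfolding grad_drift_def by (rule SUP_upper2[of "(u, p)"]) auto
  from enn2real_mono[OF this] assms
  show "norm (grad (\<phi> p) u - grad (\<phi>' p) u) \<le> enn2real (grad_drift \<phi> \<phi>')"
    by (simp add: top.not_eq_extremum)
qed

text \<open>Covers equal times, about which the drift hypothesis says nothing.\<close>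

lemma grad_drift_refl: "grad_drift \<phi> \<phi> = 0"
  unfolding grad_drift_def by (simp add: SUP_eq_const case_prod_unfold)

text \<open>The locale describes one fixed outcome.\<close>

locale decision_dependent =
  fixes \<mu> L \<gamma> \<mu>hat :: real and f :: "nat \<Rightarrow> 'a::euclidean_space \<Rightarrow> 'a \<Rightarrow> real"
    and r :: "'a \<Rightarrow> ereal" and xbar :: "nat \<Rightarrow> 'a"
  assumes \<mu>_pos: "0 < \<mu>" and \<gamma>_nonneg: "0 \<le> \<gamma>" and \<gamma>_less: "\<gamma> < \<mu> / 2"
    and \<mu>hat_eq: "\<mu>hat = \<mu> - 2 * \<gamma>"
    and convex_loss: "\<And>t p. strongly_convex \<mu> (f t p)"
    and smooth_loss: "\<And>t p. smooth_fun L (f t p)"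
    and reg: "proper_closed_convex r"
    and sens: "\<And>t p q u. norm (grad (f t p) u - grad (f t q) u) \<le> \<gamma> * norm (p - q)"
    and equil: "\<And>t. is_equilibrium (f t) r (xbar t)"
begin

text \<open>Since \<open>real_of_ereal\<close> sends infinity to 0, this is the gap only where
  \<open>r\<close> is finite; hence the finiteness conditions that accompany it.\<close>

definition rgap :: "nat \<Rightarrow> 'a \<Rightarrow> real" where
  "rgap t u = f t (xbar t) u + real_of_ereal (r u)
     - (f t (xbar t) (xbar t) + real_of_ereal (r (xbar t)))"

lemma \<mu>hat_pos: "0 < \<mu>hat" and \<mu>hat_le: "\<mu>hat \<le> \<mu>"
  using \<gamma>_less \<gamma>_nonneg by (auto simp: \<mu>hat_eq)

lemma \<mu>_le_L: "\<mu> \<le> L"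
  by (rule strong_convexity_le_smoothness[OF convex_loss smooth_loss])

lemma r_ne_MInf: "r u \<noteq> - \<infinity>"
  using reg by (simp add: proper_closed_convex_def)

lemma xbar_min:
  shows r_xbar: "r (xbar t) \<noteq> \<infinity>"
    and "r u \<noteq> \<infinity> \<Longrightarrow> f t (xbar t) (xbar t) + real_of_ereal (r (xbar t))
      \<le> f t (xbar t) u + real_of_ereal (r u)"
proof -
  obtain v where v: "r v \<noteq> \<infinity>" using reg by (auto simp: proper_closed_convex_def)
  have "is_arg_min (\<lambda>u. r u + ereal (f t (xbar t) u)) (\<lambda>_. True) (xbar t)"
    using equil[of t] by (simp add: is_equilibrium_def objective_def[abs_def] add.commute)
  note m = arg_min_add_real[where h = r, OF r_ne_MInf v this]
  show "r (xbar t) \<noteq> \<infinity>" by (rule m(1))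
  show "f t (xbar t) (xbar t) + real_of_ereal (r (xbar t)) \<le> f t (xbar t) u + real_of_ereal (r u)"
    if "r u \<noteq> \<infinity>" using m(2)[OF that] by simp
qed

lemma gap_eq:
  shows "gap (f t) r (xbar t) u = (if r u = \<infinity> then \<infinity> else ereal (rgap t u))"
proof -
  have "(INF v. objective (f t) r (xbar t) v) = objective (f t) r (xbar t) (xbar t)"
    using equil[of t] by (intro antisym INF_lower INF_greatest)
      (auto simp: is_equilibrium_def is_arg_min_linorder)
  thus ?thesis using r_xbar[of t] r_ne_MInf[of u] r_ne_MInf[of "xbar t"]
    unfolding gap_def objective_def rgap_def
    by (cases "r u"; cases "r (xbar t)") auto
qed

text \<open>Minimality of \<open>xbar t\<close> is tested along the segment towards
  \<open>u\<close>; the strong convexity of the loss survives in the part linear in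
  \<open>\<theta>\<close>.\<close>

lemma rgap_growth:
  assumes u: "r u \<noteq> \<infinity>"
  shows "\<mu> / 2 * (norm (u - xbar t))\<^sup>2 \<le> rgap t u"
proof -
  let ?x = "xbar t" and ?\<psi> = "\<lambda>u. f t (xbar t) u + real_of_ereal (r u)"
  let ?n = "(norm (u - ?x))\<^sup>2"
  have "0 \<le> ?\<psi> u - ?\<psi> ?x - \<mu> / 2 * ?n"
  proof (rule linear_part_nonneg)
    fix \<theta> :: real assume \<theta>: "0 < \<theta>" "\<theta> \<le> 1"
    let ?q = "?x + \<theta> *\<^sub>R (u - ?x)"
    have q: "r ?q \<noteq> \<infinity>" "real_of_ereal (r ?q) \<le> (1 - \<theta>) * real_of_ereal (r ?x) + \<theta> * real_of_ereal (r u)"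
      using convex_epigraph_segment[OF reg u r_xbar, of \<theta> t] \<theta> by auto
    have "?\<psi> ?x \<le> ?\<psi> ?q" by (rule xbar_min(2)[OF q(1)])
    moreover have "f t ?x ?q \<le> (1 - \<theta>) * f t ?x ?x + \<theta> * f t ?x u - \<mu> / 2 * \<theta> * (1 - \<theta>) * ?n"
      using strongly_convexD[OF convex_loss, of \<theta>] \<theta> by simp
    ultimately have "?\<psi> ?x \<le> (1 - \<theta>) * ?\<psi> ?x + \<theta> * ?\<psi> u - \<mu> / 2 * \<theta> * (1 - \<theta>) * ?n"
      using q(2) by (simp add: algebra_simps)
    thus "0 \<le> \<theta> * (?\<psi> u - ?\<psi> ?x - \<mu> / 2 * ?n) + \<theta>\<^sup>2 * (\<mu> / 2 * ?n)"
      by (simp add: field_simps power2_eq_square)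
  qed
  thus ?thesis by (simp add: rgap_def)
qed

lemma rgap_nonneg: "r u \<noteq> \<infinity> \<Longrightarrow> 0 \<le> rgap t u"
  using order_trans[OF _ rgap_growth[of u t], of 0] \<mu>_pos by simp

lemma rgap_segment:
  assumes "r u \<noteq> \<infinity>" "r v \<noteq> \<infinity>" "0 \<le> \<theta>" "\<theta> \<le> 1"
  shows "rgap t (v + \<theta> *\<^sub>R (u - v)) \<le> (1 - \<theta>) * rgap t v + \<theta> * rgap t u"
proof -
  have "f t (xbar t) (v + \<theta> *\<^sub>R (u - v)) \<le> (1 - \<theta>) * f t (xbar t) v + \<theta> * f t (xbar t) u
      - \<mu> / 2 * \<theta> * (1 - \<theta>) * (norm (u - v))\<^sup>2"
    by (rule strongly_convexD[OF convex_loss assms(3,4)])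
  moreover have "0 \<le> \<mu> / 2 * \<theta> * (1 - \<theta>) * (norm (u - v))\<^sup>2"
    using assms \<mu>_pos by simp
  ultimately show ?thesis
    using convex_epigraph_segment(2)[OF reg assms]
    unfolding rgap_def by (simp add: left_diff_distrib right_diff_distrib distrib_left distrib_right)
qed

text \<open>Splits the mismatch at \<open>f t p\<close>: changing the time at decision
  \<open>p\<close> costs \<open>G\<close>, changing the decision at time \<open>t\<close> costs the
  sensitivity term.\<close>

lemma grad_diff_bound:
  assumes "bounded_drift (f i) (f t) G"
  shows "norm (grad (f i p) u - grad (f t q) u) \<le> G + \<gamma> * norm (p - q)"
proof -
  have "norm (grad (f i p) u - grad (f t q) u)
      \<le> norm (grad (f i p) u - grad (f t p) u) + norm (grad (f t p) u - grad (f t q) u)"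
    using norm_triangle_ineq[of "grad (f i p) u - grad (f t p) u" "grad (f t p) u - grad (f t q) u"] by simp
  moreover have "norm (grad (f i p) u - grad (f t p) u) \<le> G"
    using assms by (simp add: bounded_drift_def)
  ultimately show ?thesis using sens[of t p u q] by simp
qed

text \<open>Each equilibrium is tested as a competitor in the problem of the other time. In the sum
  of the two gaps the common regularizer cancels, leaving loss increments; the sensitivity term is
  then moved to the left.\<close>

lemma equilibrium_drift:
  assumes G: "bounded_drift (f i) (f t) G"
  shows "(\<mu> - \<gamma>) * norm (xbar t - xbar i) \<le> G"
proof -
  let ?d = "norm (xbar t - xbar i)"
  have G0: "0 \<le> G" using G unfolding bounded_drift_def by (meson norm_ge_zero order_trans)
  have "\<mu> / 2 * ?d\<^sup>2 \<le> rgap i (xbar t)" "\<mu> / 2 * ?d\<^sup>2 \<le> rgap t (xbar i)"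
    using rgap_growth[OF r_xbar, of i t] rgap_growth[OF r_xbar, of t i] by (simp_all add: norm_minus_commute)
  moreover have "rgap i (xbar t) + rgap t (xbar i) \<le> (G + \<gamma> * norm (xbar i - xbar t)) * ?d"
    using smooth_fun_diff_bound[OF smooth_loss[of i "xbar i"] smooth_loss[of t "xbar t"]
        grad_diff_bound[OF G], of "xbar t" "xbar i"] unfolding rgap_def by simp
  ultimately have "\<mu> * ?d\<^sup>2 \<le> (G + \<gamma> * ?d) * ?d" by (simp add: norm_minus_commute)
  hence "((\<mu> - \<gamma>) * ?d) * ?d \<le> G * ?d" by (simp add: power2_eq_square algebra_simps)
  thus ?thesis using G0 by (cases "?d = 0") (auto simp: mult_le_cancel_right)
qed

text \<open>Measured from the common point \<open>xbar t\<close>, the two gaps differ by loss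
  increments only, with gradient mismatch at most \<open>2 * G\<close> because
  \<open>\<gamma> < \<mu> - \<gamma>\<close>. By quadratic growth, half of the gap at time
  \<open>t\<close> pays for the distance that appears, hence the factor 2.\<close>

lemma gap_transfer:
  assumes G: "bounded_drift (f i) (f t) G" and u: "r u \<noteq> \<infinity>"
  shows "rgap t u \<le> 2 * rgap i u + 8 * G\<^sup>2 / \<mu>"
proof -
  let ?d = "norm (u - xbar t)" and ?e = "norm (xbar t - xbar i)"
  have G0: "0 \<le> G" using G unfolding bounded_drift_def by (meson norm_ge_zero order_trans)
  have "\<gamma> * ?e \<le> (\<mu> - \<gamma>) * ?e" using \<gamma>_less \<gamma>_nonneg by (intro mult_right_mono) auto
  with equilibrium_drift[OF G] have e: "\<gamma> * ?e \<le> G" by simp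
  have "(f t (xbar t) u - f t (xbar t) (xbar t)) - (f i (xbar i) u - f i (xbar i) (xbar t))
      \<le> (G + \<gamma> * ?e) * ?d"
  proof (rule smooth_fun_diff_bound[OF smooth_loss smooth_loss])
    show "norm (grad (f t (xbar t)) p - grad (f i (xbar i)) p) \<le> G + \<gamma> * ?e" for p
      using grad_diff_bound[OF G, of "xbar i" p "xbar t"] by (simp add: norm_minus_commute)
  qed
  also have "\<dots> \<le> 2 * G * ?d" using e by (intro mult_right_mono) auto
  finally have "rgap t u \<le> rgap i u - rgap i (xbar t) + 2 * G * ?d"
    unfolding rgap_def by simp
  also have "\<dots> \<le> rgap i u + 2 * G * ?d" using rgap_nonneg[OF r_xbar] by simp
  also have "2 * G * ?d \<le> \<mu> / 4 * ?d\<^sup>2 + 4 * G\<^sup>2 / \<mu>"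
  proof -
    have "0 \<le> (\<mu> * ?d - 4 * G)\<^sup>2 / (4 * \<mu>)" using \<mu>_pos by simp
    also have "\<dots> = \<mu> / 4 * ?d\<^sup>2 + 4 * G\<^sup>2 / \<mu> - 2 * G * ?d"
      using \<mu>_pos by (simp add: field_simps power2_eq_square)
    finally show ?thesis by simp
  qed
  also have "\<mu> / 4 * ?d\<^sup>2 \<le> rgap t u / 2" using rgap_growth[OF u, of t] by simp
  finally show ?thesis by simp
qed

end

section \<open>Contraction of the averaged method over one epoch\<close>

lemma linear_recursion_bound:
  fixes V w :: "nat \<Rightarrow> real"
  assumes "\<And>j. j < n \<Longrightarrow> V (Suc j) \<le> q * V j + w j" and q: "0 \<le> q"
  shows "V n \<le> q ^ n * V 0 + (\<Sum>j<n. q ^ (n - Suc j) * w j)"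
  using assms(1)
proof (induction n)
  case (Suc n)
  have "V (Suc n) \<le> q * V n + w n" by (rule Suc.prems) simp
  also have "q * V n \<le> q * (q ^ n * V 0 + (\<Sum>j<n. q ^ (n - Suc j) * w j))"
    using Suc q by (intro mult_left_mono) auto
  also have "\<dots> = q ^ Suc n * V 0 + (\<Sum>j<n. q ^ (Suc n - Suc j) * w j)"
  proof -
    have "q * (\<Sum>j<n. q ^ (n - Suc j) * w j) = (\<Sum>j<n. q ^ (Suc n - Suc j) * w j)"
      unfolding sum_distrib_left mult.assoc[symmetric] power_Suc[symmetric]
      by (intro sum.cong) (simp_all add: Suc_diff_Suc)
    thus ?thesis by (simp add: distrib_left mult.assoc)
  qed
  finally show ?case by simp
qed simp

context decision_dependent
begin

lemma averaging_weight:
  assumes "0 < \<eta>" "L * \<eta> \<le> 1 / 2" and \<rho>: "\<rho> = \<mu>hat * \<eta> / (2 - \<mu> * \<eta>)"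
  shows "\<mu>hat * \<eta> / 2 \<le> \<rho>" "0 < \<rho>" "\<rho> \<le> 1" "\<mu> * \<eta> \<le> 1 / 2"
proof -
  have "\<mu> * \<eta> \<le> L * \<eta>" using \<mu>_le_L assms by (intro mult_right_mono) auto
  thus \<mu>: "\<mu> * \<eta> \<le> 1 / 2" using assms(2) by linarith
  have h: "\<mu>hat * \<eta> \<le> \<mu> * \<eta>" using \<mu>hat_le assms by (intro mult_right_mono) auto
  have p: "0 < \<mu>hat * \<eta>" "0 < \<mu> * \<eta>" using \<mu>hat_pos \<mu>_pos assms by simp_all
  show "\<mu>hat * \<eta> / 2 \<le> \<rho>" unfolding \<rho>
    using p \<mu> by (intro divide_left_mono) (auto simp: mult.commute[of \<eta> \<mu>])
  show "0 < \<rho>" unfolding \<rho> using p \<mu> by (intro divide_pos_pos) auto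
  show "\<rho> \<le> 1" unfolding \<rho> using p \<mu> h by (simp add: field_simps)
qed

text \<open>Adds up the descent bound from \<open>x\<close> to \<open>p\<close>, strong convexity
  between \<open>x\<close> and the target, the change of loss from \<open>f i x\<close> to
  \<open>f t (xbar t)\<close>, and the three-point inequality. The noise stays paired with
  \<open>x - xbar t\<close>, because \<open>p\<close> already depends on \<open>z\<close>; the
  remainder, paired with \<open>p - x\<close>, is absorbed.\<close>

lemma prox_step:
  assumes G: "bounded_drift (f i) (f t) G" and \<eta>: "0 < \<eta>" "L * \<eta> \<le> 1 / 2"
    and p: "is_prox \<eta> r (x - \<eta> *\<^sub>R g) p" and z: "z = grad (f i x) x - g"
  shows "2 * \<eta> * rgap t p \<le> (1 - \<mu> * \<eta>) * (norm (x - xbar t))\<^sup>2 - (norm (p - xbar t))\<^sup>2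
    + 2 * \<eta> * (z \<bullet> (x - xbar t)) + 2 * \<eta>\<^sup>2 * (norm z)\<^sup>2
    + 2 * \<eta> * ((G + \<gamma> * norm (x - xbar t)) * norm (p - xbar t))"
proof -
  define a u where "a = grad (f i x) x" and "u = xbar t"
  define P2 d2 e2 where "P2 = (norm (p - x))\<^sup>2" and "d2 = (norm (u - x))\<^sup>2" and "e2 = (norm (u - p))\<^sup>2"
  define B where "B = (G + \<gamma> * norm (x - u)) * norm (p - u)"
  define pa ua pg ug where "pa = (p - x) \<bullet> a" and "ua = (u - x) \<bullet> a" and "pg = (p - x) \<bullet> g" and "ug = (u - x) \<bullet> g"
  have "f i x p - f i x u \<le> pa - ua + L / 2 * P2 - \<mu> / 2 * d2"
    using smooth_fun_upper[OF smooth_loss[of i x], of p x]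
      strongly_convex_lower[OF convex_loss smooth_loss, of i x x u]
    unfolding a_def u_def P2_def d2_def pa_def ua_def by simp
  moreover have "(f t u p - f t u u) - (f i x p - f i x u) \<le> B"
    unfolding B_def
  proof (rule smooth_fun_diff_bound[OF smooth_loss smooth_loss])
    show "norm (grad (f t u) q - grad (f i x) q) \<le> G + \<gamma> * norm (x - u)" for q
      using grad_diff_bound[OF G, of x q u] by (simp add: norm_minus_commute)
  qed
  ultimately have f: "2 * \<eta> * (f t u p - f t u u)
      \<le> 2 * \<eta> * (pa - ua + L / 2 * P2 - \<mu> / 2 * d2 + B)"
    using \<eta> by (intro mult_left_mono) auto
  have sq: "(norm (v - (x - \<eta> *\<^sub>R g)))\<^sup>2 = (norm (v - x))\<^sup>2 + 2 * \<eta> * ((v - x) \<bullet> g) + (norm (\<eta> *\<^sub>R g))\<^sup>2" for v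
    using power2_norm_add[of "v - x" "\<eta> *\<^sub>R g"] by (simp add: algebra_simps)
  have r: "2 * \<eta> * (real_of_ereal (r p) - real_of_ereal (r u)) \<le> d2 + 2 * \<eta> * ug - P2 - 2 * \<eta> * pg - e2"
    using prox_three_point[OF reg \<eta>(1) p r_xbar, of t] unfolding sq
    unfolding u_def d2_def P2_def e2_def ug_def pg_def by simp
  have zp: "(p - x) \<bullet> z = pa - pg" "(u - x) \<bullet> z = ua - ug"
    unfolding z pa_def pg_def ua_def ug_def a_def by (simp_all add: inner_diff_right)
  \<comment> \<open>Young's inequality for the noise paired with \<open>p - x\<close>. Its
    \<open>P2 / 2\<close>, and the \<open>P2 / 2\<close> that comes from
    \<open>L * \<eta> \<le> 1 / 2\<close>, together use up the \<open>- P2\<close> of the proximal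
    step.\<close>
  have "0 \<le> (norm ((p - x) + (- (2 * \<eta>)) *\<^sub>R z))\<^sup>2" by simp
  also have "\<dots> = P2 - 4 * \<eta> * (pa - pg) + 4 * \<eta>\<^sup>2 * (norm z)\<^sup>2"
    unfolding power2_norm_add P2_def by (simp add: zp power_mult_distrib)
  finally have y: "2 * \<eta> * (pa - pg) \<le> P2 / 2 + 2 * \<eta>\<^sup>2 * (norm z)\<^sup>2" by simp
  have P: "(L * \<eta>) * P2 \<le> 1 / 2 * P2" unfolding P2_def using \<eta> by (intro mult_right_mono) auto
  have "2 * \<eta> * rgap t p = 2 * \<eta> * (f t u p - f t u u) + 2 * \<eta> * (real_of_ereal (r p) - real_of_ereal (r u))"
    by (simp add: rgap_def u_def algebra_simps)
  also have "\<dots> \<le> 2 * \<eta> * (pa - ua + L / 2 * P2 - \<mu> / 2 * d2 + B) + (d2 + 2 * \<eta> * ug - P2 - 2 * \<eta> * pg - e2)"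
    using f r by simp
  also have "\<dots> = (1 - \<mu> * \<eta>) * d2 - e2 - 2 * \<eta> * (ua - ug) + 2 * \<eta> * (pa - pg) + (L * \<eta>) * P2 - P2 + 2 * \<eta> * B"
    by (simp add: algebra_simps)
  also have "\<dots> \<le> (1 - \<mu> * \<eta>) * d2 - e2 - 2 * \<eta> * (ua - ug) + 2 * \<eta>\<^sup>2 * (norm z)\<^sup>2 + 2 * \<eta> * B"
    using y P by linarith
  also have "\<dots> = (1 - \<mu> * \<eta>) * d2 - e2 + 2 * \<eta> * (z \<bullet> (x - u)) + 2 * \<eta>\<^sup>2 * (norm z)\<^sup>2 + 2 * \<eta> * B"
  proof -
    have "z \<bullet> (x - u) = - ((u - x) \<bullet> z)"
      unfolding inner_commute[of z] by (simp add: inner_diff_left)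
    thus ?thesis by (simp add: zp(2) right_diff_distrib)
  qed
  finally show ?thesis
    unfolding u_def d2_def e2_def B_def by (simp add: norm_minus_commute)
qed

text \<open>The origin of the averaging weight: after Young's inequality the old and the new squared
  distance carry the coefficients \<open>1 - (\<mu> - \<gamma>) * \<eta>\<close> and
  \<open>1 - \<mu> * \<eta> / 2\<close>, whose quotient is exactly
  \<open>1 - \<rho>\<close>.\<close>

lemma lyapunov_step:
  assumes G: "bounded_drift (f i) (f t) G" and \<eta>: "0 < \<eta>" "L * \<eta> \<le> 1 / 2"
    and \<rho>: "\<rho> = \<mu>hat * \<eta> / (2 - \<mu> * \<eta>)"
    and p: "is_prox \<eta> r (x - \<eta> *\<^sub>R g) p" and z: "z = grad (f i x) x - g"
  shows "\<rho> * rgap t p + \<mu>hat / 4 * (norm (p - xbar t))\<^sup>2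
    \<le> (1 - \<rho>) * (\<mu>hat / 4 * (norm (x - xbar t))\<^sup>2)
      + \<rho> * (z \<bullet> (x - xbar t) + \<eta> * (norm z)\<^sup>2 + G\<^sup>2 / \<mu>hat)"
proof -
  define d e W where "d = norm (x - xbar t)" and "e = norm (p - xbar t)"
    and "W = z \<bullet> (x - xbar t) + \<eta> * (norm z)\<^sup>2 + G\<^sup>2 / \<mu>hat"
  note w = averaging_weight[OF \<eta> \<rho>]
  \<comment> \<open>The share \<open>\<mu>hat / 2\<close> of the new squared distance is chosen so
    that it adds up with the \<open>\<gamma>\<close> of the next estimate to
    \<open>\<mu> / 2\<close>.\<close>
  have "0 \<le> (\<mu>hat * e - 2 * G)\<^sup>2 / (2 * \<mu>hat)" using \<mu>hat_pos by simp
  also have "\<dots> = \<mu>hat / 2 * e\<^sup>2 + 2 * G\<^sup>2 / \<mu>hat - 2 * G * e"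
    using \<mu>hat_pos by (simp add: field_simps power2_eq_square)
  finally have 1: "2 * G * e \<le> \<mu>hat / 2 * e\<^sup>2 + 2 * G\<^sup>2 / \<mu>hat" by simp
  have "0 \<le> \<gamma> * (d - e)\<^sup>2" using \<gamma>_nonneg by simp
  hence 2: "2 * (\<gamma> * d) * e \<le> \<gamma> * d\<^sup>2 + \<gamma> * e\<^sup>2"
    by (simp add: algebra_simps power2_eq_square)
  have "2 * \<eta> * ((G + \<gamma> * d) * e) = \<eta> * (2 * G * e + 2 * (\<gamma> * d) * e)" by (simp add: algebra_simps)
  also have "\<dots> \<le> \<eta> * ((\<mu>hat / 2 * e\<^sup>2 + 2 * G\<^sup>2 / \<mu>hat) + (\<gamma> * d\<^sup>2 + \<gamma> * e\<^sup>2))"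
    using 1 2 \<eta> by (intro mult_left_mono add_mono) auto
  finally have 3: "2 * \<eta> * rgap t p \<le> (1 - \<mu> * \<eta>) * d\<^sup>2 - e\<^sup>2 + 2 * \<eta> * (z \<bullet> (x - xbar t)) + 2 * \<eta>\<^sup>2 * (norm z)\<^sup>2
      + \<eta> * ((\<mu>hat / 2 * e\<^sup>2 + 2 * G\<^sup>2 / \<mu>hat) + (\<gamma> * d\<^sup>2 + \<gamma> * e\<^sup>2))"
    using prox_step[OF G \<eta> p z] by (simp add: d_def e_def)
  also have "\<dots> = (1 - (\<mu> - \<gamma>) * \<eta>) * d\<^sup>2 - (1 - \<mu> * \<eta> / 2) * e\<^sup>2 + 2 * \<eta> * W"
    unfolding W_def \<mu>hat_eq using \<mu>hat_pos \<mu>hat_eq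
    by (simp add: field_simps power2_eq_square)
  finally have 4: "2 * \<eta> * rgap t p \<le> (1 - (\<mu> - \<gamma>) * \<eta>) * d\<^sup>2 - (1 - \<mu> * \<eta> / 2) * e\<^sup>2 + 2 * \<eta> * W" .
  define k where "k = 2 - \<mu> * \<eta>"
  \<comment> \<open>This multiplier turns the coefficient \<open>2 * \<eta>\<close> of the gap into
    \<open>\<rho>\<close>, the weight with which the new iterate enters the average.\<close>
  define c where "c = \<mu>hat / (2 * k)"
  have k: "0 < k" "1 - \<mu> * \<eta> / 2 = k / 2" "1 - (\<mu> - \<gamma>) * \<eta> = (k - \<mu>hat * \<eta>) / 2"
    using w by (simp_all add: k_def \<mu>hat_eq algebra_simps)
  have \<rho>k: "\<rho> = \<mu>hat * \<eta> / k" by (simp add: \<rho> k_def)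
  have c: "0 \<le> c" "c * (2 * \<eta>) = \<rho>" "c * (1 - \<mu> * \<eta> / 2) = \<mu>hat / 4"
    using \<mu>hat_pos k(1) by (simp_all add: c_def \<rho>k k(2))
  have "c * (1 - (\<mu> - \<gamma>) * \<eta>) = (1 - \<rho>) * (\<mu>hat / 4)"
    using k(1) unfolding c_def \<rho>k k(3) by (simp add: field_simps)
  note c = c this
  have expand: "c * (A * d\<^sup>2 - B * e\<^sup>2 + 2 * \<eta> * W) = (c * A) * d\<^sup>2 - (c * B) * e\<^sup>2 + (c * (2 * \<eta>)) * W"
    "c * (2 * \<eta> * R) = (c * (2 * \<eta>)) * R" for A B R
    by (simp_all add: algebra_simps)
  have "c * (2 * \<eta> * rgap t p) \<le> c * ((1 - (\<mu> - \<gamma>) * \<eta>) * d\<^sup>2 - (1 - \<mu> * \<eta> / 2) * e\<^sup>2 + 2 * \<eta> * W)"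
    using 4 c(1) by (rule mult_left_mono)
  hence "(c * (2 * \<eta>)) * rgap t p \<le> (c * (1 - (\<mu> - \<gamma>) * \<eta>)) * d\<^sup>2
      - (c * (1 - \<mu> * \<eta> / 2)) * e\<^sup>2 + (c * (2 * \<eta>)) * W"
    unfolding expand .
  thus ?thesis unfolding c W_def[symmetric] d_def[symmetric] e_def[symmetric] by (simp add: mult.assoc)
qed

text \<open>A crude growth bound whose sole purpose is to carry square integrability from one
  iterate to the next.\<close>

lemma iterate_dist_step:
  assumes G: "bounded_drift (f i) (f t) G" and \<eta>: "0 < \<eta>" "L * \<eta> \<le> 1 / 2"
    and p: "is_prox \<eta> r (x - \<eta> *\<^sub>R g) p" and z: "z = grad (f i x) x - g"
  shows "(norm (p - xbar t))\<^sup>2 \<le> (1 + 4 / \<mu>hat * (1 + \<eta> + 1 / \<mu>hat))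
    * ((norm (x - xbar t))\<^sup>2 + (norm z)\<^sup>2 + G\<^sup>2)"
proof -
  define d2 e2 z2 where "d2 = (norm (x - xbar t))\<^sup>2" and "e2 = (norm (p - xbar t))\<^sup>2" and "z2 = (norm z)\<^sup>2"
  have nn: "0 \<le> d2" "0 \<le> e2" "0 \<le> z2" by (simp_all add: d2_def e2_def z2_def)
  define \<rho> where "\<rho> = \<mu>hat * \<eta> / (2 - \<mu> * \<eta>)"
  note w = averaging_weight[OF \<eta> \<rho>_def]
  let ?S = "d2 + z2 + G\<^sup>2"
  have "z \<bullet> (x - xbar t) \<le> z2 + d2"
  proof -
    have "z \<bullet> (x - xbar t) \<le> norm z * norm (x - xbar t)" by (rule norm_cauchy_schwarz)
    also have "\<dots> \<le> z2 + d2" unfolding z2_def d2_def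
      using sum_squares_bound[of "norm z" "norm (x - xbar t)"]
        mult_nonneg_nonneg[OF norm_ge_zero[of z] norm_ge_zero[of "x - xbar t"]] by linarith
    finally show ?thesis .
  qed
  moreover have "\<eta> * z2 \<le> \<eta> * ?S" "G\<^sup>2 / \<mu>hat \<le> ?S / \<mu>hat"
    using \<eta> nn \<mu>hat_pos by (auto intro!: mult_left_mono divide_right_mono)
  ultimately have "z \<bullet> (x - xbar t) + \<eta> * z2 + G\<^sup>2 / \<mu>hat \<le> (1 + \<eta> + 1 / \<mu>hat) * ?S"
  proof -
    have "(1 + \<eta> + 1 / \<mu>hat) * ?S = ?S + \<eta> * ?S + ?S / \<mu>hat" by (simp add: distrib_right)
    thus "z \<bullet> (x - xbar t) \<le> z2 + d2 \<Longrightarrow> \<eta> * z2 \<le> \<eta> * ?S \<Longrightarrow> G\<^sup>2 / \<mu>hat \<le> ?S / \<mu>hat \<Longrightarrow> ?thesis"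
      using zero_le_power2[of G] by linarith
  qed
  hence "\<rho> * (z \<bullet> (x - xbar t) + \<eta> * z2 + G\<^sup>2 / \<mu>hat) \<le> \<rho> * ((1 + \<eta> + 1 / \<mu>hat) * ?S)"
    using w by (intro mult_left_mono) auto
  also have "\<dots> \<le> 1 * ((1 + \<eta> + 1 / \<mu>hat) * ?S)"
    using w nn \<eta> \<mu>hat_pos by (intro mult_right_mono) auto
  finally have 1: "\<rho> * (z \<bullet> (x - xbar t) + \<eta> * z2 + G\<^sup>2 / \<mu>hat) \<le> (1 + \<eta> + 1 / \<mu>hat) * ?S" by simp
  have "0 \<le> \<rho> * rgap t p"
    using w rgap_nonneg[OF prox_finite[OF reg p]] by simp
  moreover have "(1 - \<rho>) * (\<mu>hat / 4 * d2) \<le> \<mu>hat / 4 * d2"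
    using w nn \<mu>hat_pos by (simp add: mult_left_le_one_le)
  ultimately have "\<mu>hat / 4 * e2 \<le> \<mu>hat / 4 * d2 + (1 + \<eta> + 1 / \<mu>hat) * ?S"
    using lyapunov_step[OF G \<eta> \<rho>_def p z] 1 unfolding d2_def e2_def z2_def by linarith
  hence "4 / \<mu>hat * (\<mu>hat / 4 * e2) \<le> 4 / \<mu>hat * (\<mu>hat / 4 * d2 + (1 + \<eta> + 1 / \<mu>hat) * ?S)"
    using \<mu>hat_pos by (intro mult_left_mono) auto
  also have "\<dots> = d2 + 4 / \<mu>hat * (1 + \<eta> + 1 / \<mu>hat) * ?S"
    using \<mu>hat_pos by (subst distrib_left) (simp add: mult.assoc)
  also have "\<dots> \<le> (1 + 4 / \<mu>hat * (1 + \<eta> + 1 / \<mu>hat)) * ?S"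
    using nn by (simp add: distrib_right)
  finally show ?thesis using \<mu>hat_pos by (simp add: d2_def e2_def z2_def)
qed

lemma averaged_run_finite:
  assumes run: "averaged_prox_run \<mu> \<mu>hat \<eta> s n (\<lambda>_. r) g X y yh"
    and \<eta>: "0 < \<eta>" "L * \<eta> \<le> 1 / 2" and X: "r X \<noteq> \<infinity>" and j: "j \<le> n"
  shows "r (yh j) \<noteq> \<infinity>"
  using j
proof (induction j)
  case 0
  thus ?case using run X by (simp add: averaged_prox_run_def)
next
  case (Suc j)
  define \<rho> where "\<rho> = \<mu>hat * \<eta> / (2 - \<mu> * \<eta>)"
  note w = averaging_weight[OF \<eta> \<rho>_def]
  have p: "is_prox \<eta> r (y j - \<eta> *\<^sub>R g (s + j)) (y (Suc j))"
    and e: "yh (Suc j) = (1 - \<rho>) *\<^sub>R yh j + \<rho> *\<^sub>R y (Suc j)"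
    using run Suc by (auto simp: averaged_prox_run_def \<rho>_def)
  have "yh (Suc j) = yh j + \<rho> *\<^sub>R (y (Suc j) - yh j)" unfolding e by (simp add: algebra_simps)
  thus ?case using convex_epigraph_segment(1)[OF reg prox_finite[OF reg p] Suc.IH, of \<rho>] Suc.prems w by simp
qed

text \<open>The gap on the left belongs to the end time of the epoch, the one on the right to its
  start time, so that epochs can be chained.\<close>

lemma epoch_bound:
  assumes run: "averaged_prox_run \<mu> \<mu>hat \<eta> s n (\<lambda>_. r) g X y yh"
    and \<eta>: "0 < \<eta>" "L * \<eta> \<le> 1 / 2" and \<rho>: "\<rho> = \<mu>hat * \<eta> / (2 - \<mu> * \<eta>)" and X: "r X \<noteq> \<infinity>"
    and G: "\<And>j. j \<le> n \<Longrightarrow> bounded_drift (f (s + j)) (f (s + n)) (G j)"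
    and z: "\<And>j. j < n \<Longrightarrow> z j = grad (f (s + j) (y j)) (y j) - g (s + j)"
  shows "rgap (s + n) (yh n) \<le> 3 * (1 - \<rho>) ^ n * rgap s X
    + (12 * (1 - \<rho>) ^ n / \<mu> * (G 0)\<^sup>2
    + (\<Sum>j<n. (1 - \<rho>) ^ (n - Suc j) * (\<rho> * (z j \<bullet> (y j - xbar (s + n)) + \<eta> * (norm (z j))\<^sup>2 + (G j)\<^sup>2 / \<mu>hat))))"
proof -
  let ?t = "s + n"
  let ?w = "\<lambda>j. \<rho> * (z j \<bullet> (y j - xbar ?t) + \<eta> * (norm (z j))\<^sup>2 + (G j)\<^sup>2 / \<mu>hat)"
  define V where "V j = rgap ?t (yh j) + \<mu>hat / 4 * (norm (y j - xbar ?t))\<^sup>2" for j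
  note w = averaging_weight[OF \<eta> \<rho>]
  have start: "y 0 = X" "yh 0 = X" using run by (auto simp: averaged_prox_run_def)
  have rec: "V n \<le> (1 - \<rho>) ^ n * V 0 + (\<Sum>j<n. (1 - \<rho>) ^ (n - Suc j) * ?w j)"
  proof (rule linear_recursion_bound)
    fix j assume j: "j < n"
    have p: "is_prox \<eta> r (y j - \<eta> *\<^sub>R g (s + j)) (y (Suc j))"
      and e: "yh (Suc j) = (1 - \<rho>) *\<^sub>R yh j + \<rho> *\<^sub>R y (Suc j)"
      using run j by (auto simp: averaged_prox_run_def \<rho>)
    have "yh (Suc j) = yh j + \<rho> *\<^sub>R (y (Suc j) - yh j)" unfolding e by (simp add: algebra_simps)
    hence "rgap ?t (yh (Suc j)) \<le> (1 - \<rho>) * rgap ?t (yh j) + \<rho> * rgap ?t (y (Suc j))"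
      using rgap_segment[OF prox_finite[OF reg p] averaged_run_finite[OF run \<eta> X], of j \<rho>] j w by simp
    moreover have "\<rho> * rgap ?t (y (Suc j)) + \<mu>hat / 4 * (norm (y (Suc j) - xbar ?t))\<^sup>2
      \<le> (1 - \<rho>) * (\<mu>hat / 4 * (norm (y j - xbar ?t))\<^sup>2) + ?w j"
      using j by (intro lyapunov_step[OF G \<eta> \<rho> p z]) auto
    ultimately show "V (Suc j) \<le> (1 - \<rho>) * V j + ?w j"
      unfolding V_def distrib_left[of "1 - \<rho>"] by linarith
  qed (use w in simp)
  have last: "rgap ?t (yh n) \<le> V n" using \<mu>hat_pos by (simp add: V_def)
  \<comment> \<open>By quadratic growth the distance part of \<open>V 0\<close> is at most half of
    the gap at the target time, and the transfer of the remaining \<open>3 / 2\<close> doubles it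
    and gives \<open>3 / 2 * 8 = 12\<close> for the drift.\<close>
  have "V 0 \<le> 3 * rgap s X + 12 * (G 0)\<^sup>2 / \<mu>"
  proof -
    have "\<mu>hat * (norm (X - xbar ?t))\<^sup>2 \<le> \<mu> * (norm (X - xbar ?t))\<^sup>2"
      using \<mu>hat_le by (intro mult_right_mono) auto
    hence "V 0 \<le> 3 / 2 * rgap ?t X" unfolding V_def start using rgap_growth[OF X, of ?t] by simp
    moreover have "bounded_drift (f s) (f ?t) (G 0)" using G[of 0] by simp
    note gap_transfer[OF this X]
    ultimately show ?thesis by simp
  qed
  hence "(1 - \<rho>) ^ n * V 0 \<le> (1 - \<rho>) ^ n * (3 * rgap s X + 12 * (G 0)\<^sup>2 / \<mu>)"
    using w by (intro mult_left_mono) auto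
  also have "\<dots> = 3 * (1 - \<rho>) ^ n * rgap s X + 12 * (1 - \<rho>) ^ n / \<mu> * (G 0)\<^sup>2"
    by (simp add: distrib_left)
  finally show ?thesis using rec last by linarith
qed

end

section \<open>Bounds in expectation\<close>

text \<open>The gaps of the intermediate iterates need not be measurable; their expectations are replaced
  by expectations of integrable upper bounds.\<close>

definition mean_bound :: "'w measure \<Rightarrow> ('w \<Rightarrow> real) \<Rightarrow> real \<Rightarrow> bool" where
  "mean_bound M h c \<longleftrightarrow> (\<exists>B. integrable M B \<and> (AE \<omega> in M. h \<omega> \<le> B \<omega>) \<and> integral\<^sup>L M B \<le> c)"

lemma mean_bound_integrable: "integrable M h \<Longrightarrow> integral\<^sup>L M h \<le> c \<Longrightarrow> mean_bound M h c"
  unfolding mean_bound_def by (intro exI[of _ h]) auto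

lemma mean_bound_mono:
  assumes "mean_bound M h c" "AE \<omega> in M. h' \<omega> \<le> h \<omega>" "c \<le> c'"
  shows "mean_bound M h' c'"
proof -
  obtain B where B: "integrable M B" "AE \<omega> in M. h \<omega> \<le> B \<omega>" "integral\<^sup>L M B \<le> c"
    using assms by (auto simp: mean_bound_def)
  have "AE \<omega> in M. h' \<omega> \<le> B \<omega>" using assms(2) B(2) by eventually_elim simp
  thus ?thesis using B assms(3) unfolding mean_bound_def by (intro exI[of _ B]) auto
qed

lemma mean_bound_add:
  assumes "mean_bound M h c" "mean_bound M h' c'"
  shows "mean_bound M (\<lambda>\<omega>. h \<omega> + h' \<omega>) (c + c')"
proof -
  obtain B where B: "integrable M B" "AE \<omega> in M. h \<omega> \<le> B \<omega>" "integral\<^sup>L M B \<le> c"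
    using assms by (auto simp: mean_bound_def)
  obtain B' where B': "integrable M B'" "AE \<omega> in M. h' \<omega> \<le> B' \<omega>" "integral\<^sup>L M B' \<le> c'"
    using assms by (auto simp: mean_bound_def)
  have "AE \<omega> in M. h \<omega> + h' \<omega> \<le> B \<omega> + B' \<omega>" using B(2) B'(2) by eventually_elim simp
  thus ?thesis using B B' unfolding mean_bound_def by (intro exI[of _ "\<lambda>\<omega>. B \<omega> + B' \<omega>"]) auto
qed

lemma mean_bound_scale:
  assumes "mean_bound M h c" "0 \<le> a"
  shows "mean_bound M (\<lambda>\<omega>. a * h \<omega>) (a * c)"
proof -
  obtain B where B: "integrable M B" "AE \<omega> in M. h \<omega> \<le> B \<omega>" "integral\<^sup>L M B \<le> c"
    using assms by (auto simp: mean_bound_def)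
  have "AE \<omega> in M. a * h \<omega> \<le> a * B \<omega>" using B(2) by eventually_elim (use assms in \<open>auto intro: mult_left_mono\<close>)
  moreover have "(\<integral>\<omega>. a * B \<omega> \<partial>M) \<le> a * c" using B assms by (simp add: mult_left_mono)
  ultimately show ?thesis using B unfolding mean_bound_def by (intro exI[of _ "\<lambda>\<omega>. a * B \<omega>"]) auto
qed

lemma mean_bound_sum:
  assumes "finite I" "\<And>i. i \<in> I \<Longrightarrow> mean_bound M (h i) (c i)"
  shows "mean_bound M (\<lambda>\<omega>. \<Sum>i\<in>I. h i \<omega>) (\<Sum>i\<in>I. c i)"
  using assms by (induction I) (auto intro: mean_bound_add mean_bound_integrable)

lemma mean_bound_nn_integral:
  assumes "mean_bound M h c" "AE \<omega> in M. 0 \<le> h \<omega>"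
  shows "(\<integral>\<^sup>+\<omega>. ennreal (h \<omega>) \<partial>M) \<le> ennreal c"
proof -
  obtain B where B: "integrable M B" "AE \<omega> in M. h \<omega> \<le> B \<omega>" "integral\<^sup>L M B \<le> c"
    using assms by (auto simp: mean_bound_def)
  have "(\<integral>\<^sup>+\<omega>. ennreal (h \<omega>) \<partial>M) \<le> (\<integral>\<^sup>+\<omega>. ennreal (B \<omega>) \<partial>M)"
  proof (rule nn_integral_mono_AE)
    show "AE \<omega> in M. ennreal (h \<omega>) \<le> ennreal (B \<omega>)"
      using B(2) by eventually_elim (rule ennreal_leI)
  qed
  also have "\<dots> = ennreal (integral\<^sup>L M B)"
  proof (rule nn_integral_eq_integral[OF B(1)])
    show "AE \<omega> in M. 0 \<le> B \<omega>" using B(2) assms(2) by eventually_elim simp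
  qed
  finally show ?thesis using B(3) by (meson ennreal_leI order_trans)
qed

text \<open>\<open>enn2real\<close> sends infinity to 0; the second moment confines this to a null
  set, so passing to the reals changes no integral.\<close>

lemma nn_integral_sq_bound:
  fixes h :: "'w \<Rightarrow> ennreal"
  assumes m: "h \<in> borel_measurable M" and le: "(\<integral>\<^sup>+\<omega>. (h \<omega>)\<^sup>2 \<partial>M) \<le> ennreal c" and c: "0 \<le> c"
  shows "AE \<omega> in M. h \<omega> \<noteq> \<infinity>"
    and "integrable M (\<lambda>\<omega>. (enn2real (h \<omega>))\<^sup>2)" and "(\<integral>\<omega>. (enn2real (h \<omega>))\<^sup>2 \<partial>M) \<le> c"
proof -
  have fin: "AE \<omega> in M. (h \<omega>)\<^sup>2 \<noteq> \<infinity>"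
  proof (rule nn_integral_PInf_AE)
    show "(\<lambda>\<omega>. (h \<omega>)\<^sup>2) \<in> borel_measurable M" using m by measurable
    show "(\<integral>\<^sup>+\<omega>. (h \<omega>)\<^sup>2 \<partial>M) \<noteq> \<infinity>" using le by (metis ennreal_neq_top infinity_ennreal_def top_le)
  qed
  show f: "AE \<omega> in M. h \<omega> \<noteq> \<infinity>"
    using fin by eventually_elim (auto simp: power2_eq_square)
  have eq: "(\<integral>\<^sup>+\<omega>. ennreal ((enn2real (h \<omega>))\<^sup>2) \<partial>M) = (\<integral>\<^sup>+\<omega>. (h \<omega>)\<^sup>2 \<partial>M)"
  proof (rule nn_integral_cong_AE)
    show "AE \<omega> in M. ennreal ((enn2real (h \<omega>))\<^sup>2) = (h \<omega>)\<^sup>2"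
      using f by eventually_elim (simp add: ennreal_power[symmetric] ennreal_enn2real top.not_eq_extremum)
  qed
  show i: "integrable M (\<lambda>\<omega>. (enn2real (h \<omega>))\<^sup>2)"
    using m le by (intro integrableI_bounded) (auto simp: eq intro: le_less_trans)
  have "ennreal (\<integral>\<omega>. (enn2real (h \<omega>))\<^sup>2 \<partial>M) \<le> ennreal c"
    using le nn_integral_eq_integral[OF i] eq by simp
  thus "(\<integral>\<omega>. (enn2real (h \<omega>))\<^sup>2 \<partial>M) \<le> c" using c by (simp add: ennreal_le_iff)
qed

text \<open>Uses a majorant, like the bounds for the gaps, because the averages are not assumed
  measurable. Integrability proper is recovered where measurability is known.\<close>

definition sq_bounded :: "'w measure \<Rightarrow> ('w \<Rightarrow> 'a::real_normed_vector) \<Rightarrow> bool" where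
  "sq_bounded M h \<longleftrightarrow> (\<exists>c. mean_bound M (\<lambda>\<omega>. (norm (h \<omega>))\<^sup>2) c)"

lemma sq_boundedI: "mean_bound M (\<lambda>\<omega>. (norm (h \<omega>))\<^sup>2) c \<Longrightarrow> sq_bounded M h"
  by (auto simp: sq_bounded_def)

lemma sq_bounded_cong:
  assumes "sq_bounded M h" "\<And>\<omega>. \<omega> \<in> space M \<Longrightarrow> h' \<omega> = h \<omega>"
  shows "sq_bounded M h'"
proof -
  obtain c where "mean_bound M (\<lambda>\<omega>. (norm (h \<omega>))\<^sup>2) c" using assms(1) by (auto simp: sq_bounded_def)
  from mean_bound_mono[OF this _ order_refl, of "\<lambda>\<omega>. (norm (h' \<omega>))\<^sup>2"] assms(2)
  show ?thesis by (intro sq_boundedI) auto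
qed

lemma sq_bounded_scaleR: "sq_bounded M h \<Longrightarrow> sq_bounded M (\<lambda>\<omega>. a *\<^sub>R h \<omega>)"
  using mean_bound_scale[of M "\<lambda>\<omega>. (norm (h \<omega>))\<^sup>2" _ "a\<^sup>2"]
  by (auto simp: sq_bounded_def power_mult_distrib)

lemma sq_bounded_add:
  assumes "sq_bounded M h" "sq_bounded M h'"
  shows "sq_bounded M (\<lambda>\<omega>. h \<omega> + h' \<omega>)"
proof -
  obtain c c' where c: "mean_bound M (\<lambda>\<omega>. (norm (h \<omega>))\<^sup>2) c" "mean_bound M (\<lambda>\<omega>. (norm (h' \<omega>))\<^sup>2) c'"
    using assms by (auto simp: sq_bounded_def)
  have "(norm (h \<omega> + h' \<omega>))\<^sup>2 \<le> 2 * (norm (h \<omega>))\<^sup>2 + 2 * (norm (h' \<omega>))\<^sup>2" for \<omega>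
  proof -
    have "(norm (h \<omega> + h' \<omega>))\<^sup>2 \<le> (norm (h \<omega>) + norm (h' \<omega>))\<^sup>2"
      by (intro power_mono norm_triangle_ineq) auto
    thus ?thesis using sum_squares_bound[of "norm (h \<omega>)" "norm (h' \<omega>)"] by (simp add: power2_sum)
  qed
  thus ?thesis
    by (intro sq_boundedI mean_bound_mono[OF mean_bound_add[OF mean_bound_scale[OF c(1), of 2] mean_bound_scale[OF c(2), of 2]]])
      auto
qed

lemma sq_bounded_diff:
  "sq_bounded M h \<Longrightarrow> sq_bounded M h' \<Longrightarrow> sq_bounded M (\<lambda>\<omega>. h \<omega> - h' \<omega>)"
  using sq_bounded_add[of M h "\<lambda>\<omega>. (-1) *\<^sub>R h' \<omega>"] sq_bounded_scaleR[of M h' "-1"] by simp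

lemma sq_bounded_integrable:
  fixes h :: "'w \<Rightarrow> 'a::euclidean_space"
  assumes "sq_bounded M h" and [measurable]: "h \<in> borel_measurable M"
  shows "integrable M (\<lambda>\<omega>. (norm (h \<omega>))\<^sup>2)"
proof -
  obtain B where B: "integrable M B" "AE \<omega> in M. (norm (h \<omega>))\<^sup>2 \<le> B \<omega>"
    using assms by (auto simp: sq_bounded_def mean_bound_def)
  show ?thesis
    by (rule Bochner_Integration.integrable_bound[OF B(1)]) (use B(2) in auto)
qed

lemma (in prob_space) sq_bounded_const:
  assumes "\<And>\<omega>. \<omega> \<in> space M \<Longrightarrow> h \<omega> = c"
  shows "sq_bounded M h"
proof (rule sq_boundedI, rule mean_bound_mono)
  show "mean_bound M (\<lambda>_. (norm c)\<^sup>2) ((norm c)\<^sup>2)" by (rule mean_bound_integrable) (auto simp: prob_space)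
qed (use assms in auto)

text \<open>The preimage of a value that is attained is a nonempty set of the trivial sigma-algebra,
  hence the whole space.\<close>

lemma trivial_sigma_algebra_constant:
  fixes h :: "'w \<Rightarrow> 'a::t1_space"
  assumes h: "h \<in> borel_measurable N" and N: "sets N = {{}, space M}" "space N = space M"
  obtains c where "\<And>\<omega>. \<omega> \<in> space M \<Longrightarrow> h \<omega> = c"
proof (cases "space M = {}")
  case False
  then obtain \<omega>0 where \<omega>0: "\<omega>0 \<in> space M" by auto
  have "h -` {h \<omega>0} \<inter> space N \<in> sets N" using h by (intro measurable_sets[OF h]) auto
  with \<omega>0 N have "h -` {h \<omega>0} \<inter> space M = space M" by auto
  thus ?thesis by (intro that[of "h \<omega>0"]) auto
qed (use that in auto)

text \<open>Coordinate by coordinate, \<open>v\<close> is known to \<open>F\<close>, so the noise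
  may be replaced by its conditional expectation; the second moments make the products
  integrable.\<close>

lemma (in sigma_finite_subalgebra) inner_noise_integral:
  fixes v z :: "'a \<Rightarrow> 'b::euclidean_space"
  assumes v: "v \<in> borel_measurable F" and z [measurable]: "z \<in> borel_measurable M"
    and v2: "integrable M (\<lambda>\<omega>. (norm (v \<omega>))\<^sup>2)" and z2: "integrable M (\<lambda>\<omega>. (norm (z \<omega>))\<^sup>2)"
    and ce: "AE \<omega> in M. vec_cond_exp M F z \<omega> = 0"
  shows "has_bochner_integral M (\<lambda>\<omega>. z \<omega> \<bullet> v \<omega>) 0"
proof -
  have vM [measurable]: "v \<in> borel_measurable M" by (rule measurable_from_subalg[OF subalg v])
  have b: "has_bochner_integral M (\<lambda>\<omega>. (z \<omega> \<bullet> b) * (v \<omega> \<bullet> b)) 0" if b: "b \<in> Basis" for b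
  proof -
    have le: "\<bar>(v \<omega> \<bullet> b) * (z \<omega> \<bullet> b)\<bar> \<le> (norm (v \<omega>))\<^sup>2 + (norm (z \<omega>))\<^sup>2" for \<omega>
    proof -
      have "\<bar>(v \<omega> \<bullet> b) * (z \<omega> \<bullet> b)\<bar> \<le> norm (v \<omega>) * norm (z \<omega>)"
        unfolding abs_mult using b by (intro mult_mono Basis_le_norm) auto
      thus ?thesis using sum_squares_bound[of "norm (v \<omega>)" "norm (z \<omega>)"]
        mult_nonneg_nonneg[OF norm_ge_zero[of "v \<omega>"] norm_ge_zero[of "z \<omega>"]] by linarith
    qed
    have i: "integrable M (\<lambda>\<omega>. (v \<omega> \<bullet> b) * (z \<omega> \<bullet> b))"
      by (rule Bochner_Integration.integrable_bound[OF Bochner_Integration.integrable_add[OF v2 z2]])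
        (use le in auto)
    have "AE \<omega> in M. (v \<omega> \<bullet> b) * real_cond_exp M F (\<lambda>\<omega>. z \<omega> \<bullet> b) \<omega> = 0"
      using ce
    proof eventually_elim
      case (elim \<omega>)
      have "vec_cond_exp M F z \<omega> \<bullet> b = real_cond_exp M F (\<lambda>\<omega>. z \<omega> \<bullet> b) \<omega>"
        unfolding vec_cond_exp_def using b by simp
      with elim show ?case by simp
    qed
    hence "(\<integral>\<omega>. (v \<omega> \<bullet> b) * real_cond_exp M F (\<lambda>\<omega>. z \<omega> \<bullet> b) \<omega> \<partial>M) = 0"
      by (rule integral_eq_zero_AE)
    moreover have "(\<lambda>\<omega>. v \<omega> \<bullet> b) \<in> borel_measurable F" using v by measurable
    ultimately have "(\<integral>\<omega>. (v \<omega> \<bullet> b) * (z \<omega> \<bullet> b) \<partial>M) = 0"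
      using real_cond_exp_intg(2)[OF i] by simp
    with i show ?thesis by (simp add: has_bochner_integral_iff mult.commute)
  qed
  have "has_bochner_integral M (\<lambda>\<omega>. \<Sum>b\<in>Basis. (z \<omega> \<bullet> b) * (v \<omega> \<bullet> b)) (\<Sum>b\<in>(Basis::'b set). 0)"
    by (rule has_bochner_integral_sum) (rule b)
  thus ?thesis by (simp add: euclidean_inner[symmetric])
qed

section \<open>Geometric weights against noise and drift\<close>

lemma sum_power_weights_le:
  fixes \<rho> :: real
  assumes "0 < \<rho>" "\<rho> \<le> 1"
  shows "\<rho> * (\<Sum>j<n. (1 - \<rho>) ^ (n - Suc j)) \<le> 1"
proof -
  have "\<rho> * (\<Sum>j<n. (1 - \<rho>) ^ (n - Suc j)) = \<rho> * (\<Sum>j<n. (1 - \<rho>) ^ j)"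
    by (simp add: sum.nat_diff_reindex)
  also have "\<dots> = 1 - (1 - \<rho>) ^ n" using one_diff_power_eq[of "1 - \<rho>" n] by simp
  finally show ?thesis using assms by simp
qed

lemma sum_power_weights_sq_le:
  fixes \<rho> :: real
  assumes "0 < \<rho>" "\<rho> \<le> 1"
  shows "\<rho> * (\<Sum>j<n. (1 - \<rho>) ^ (n - Suc j) * (real (n - j))\<^sup>2) \<le> 2 / \<rho>\<^sup>2"
proof -
  define q where "q = 1 - \<rho>"
  \<comment> \<open>\<open>P m\<close> is \<open>\<rho> ^ 3\<close> times the infinite tail sum of
    \<open>q ^ j * (m + 1 + j)^2\<close> over \<open>j \<ge> 0\<close>. Hence
    \<open>P n - q * P (Suc n)\<close> is a single term, and the partial sums telescope from
    \<open>P 0 = 2 - \<rho>\<close>.\<close>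
  define P where "P m = \<rho>\<^sup>2 * (real m + 1)\<^sup>2 + 2 * \<rho> * (real m + 1) * q + q * (1 + q)" for m
  have closed: "\<rho> ^ 3 * (\<Sum>m<n. q ^ m * (real m + 1)\<^sup>2) = (2 - \<rho>) - q ^ n * P n" for n
  proof (induction n)
    case 0
    show ?case by (simp add: P_def q_def power2_eq_square algebra_simps)
  next
    case (Suc n)
    have "\<rho> ^ 3 * (real n + 1)\<^sup>2 = P n - q * P (Suc n)"
      by (simp add: P_def q_def power2_eq_square power3_eq_cube algebra_simps)
    hence "\<rho> ^ 3 * (q ^ n * (real n + 1)\<^sup>2) = q ^ n * (P n - q * P (Suc n))" by (simp add: mult_ac)
    with Suc show ?case by (simp add: algebra_simps)
  qed
  have "(\<Sum>j<n. (1 - \<rho>) ^ (n - Suc j) * (real (n - j))\<^sup>2)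
      = (\<Sum>j<n. (\<lambda>m. q ^ m * (real m + 1)\<^sup>2) (n - Suc j))"
    by (intro sum.cong) (auto simp: q_def of_nat_diff)
  also have "\<dots> = (\<Sum>m<n. q ^ m * (real m + 1)\<^sup>2)" by (rule sum.nat_diff_reindex)
  finally have eq: "(\<Sum>j<n. (1 - \<rho>) ^ (n - Suc j) * (real (n - j))\<^sup>2) = (\<Sum>m<n. q ^ m * (real m + 1)\<^sup>2)" .
  have "0 \<le> P n" using assms by (simp add: P_def q_def)
  hence "0 \<le> q ^ n * P n" using assms by (simp add: q_def)
  hence "\<rho> ^ 3 * (\<Sum>m<n. q ^ m * (real m + 1)\<^sup>2) \<le> 2" using closed assms by simp
  hence "\<rho>\<^sup>2 * (\<rho> * (\<Sum>m<n. q ^ m * (real m + 1)\<^sup>2)) \<le> 2"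
    by (simp add: power2_eq_square power3_eq_cube mult.assoc)
  thus ?thesis unfolding eq using assms by (simp add: pos_le_divide_eq mult.commute)
qed

lemma power_le_exp:
  fixes \<rho> :: real
  assumes "0 \<le> \<rho>" "\<rho> \<le> 1"
  shows "(1 - \<rho>) ^ n \<le> exp (- \<rho> * real n)"
proof -
  have "(1 - \<rho>) ^ n \<le> exp (- \<rho>) ^ n"
    using assms exp_ge_add_one_self[of "- \<rho>"] by (intro power_mono) auto
  thus ?thesis by (simp add: exp_of_nat_mult[symmetric] mult.commute)
qed

text \<open>For the drift across a whole epoch, which grows like its length \<open>n\<close>: the
  contraction of the starting gap outweighs it, whatever \<open>n\<close> is.\<close>

lemma power_mult_sq_le:
  fixes \<rho> :: real
  assumes "0 < \<rho>" "\<rho> \<le> 1"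
  shows "(1 - \<rho>) ^ n * (real n)\<^sup>2 \<le> 1 / \<rho>\<^sup>2"
proof -
  define a where "a = \<rho> * real n"
  have a: "0 \<le> a" using assms by (simp add: a_def)
  have "2 * (a / 2) \<le> exp 1 * exp (a / 2 - 1)"
    using exp_ge_add_one_self[of 1] exp_ge_add_one_self[of "a / 2 - 1"] a by (intro mult_mono) auto
  also have "\<dots> = exp (a / 2)" by (simp flip: exp_add)
  finally have "a\<^sup>2 \<le> (exp (a / 2))\<^sup>2" using a by (intro power_mono) auto
  also have "\<dots> = exp a" by (simp add: power2_eq_square flip: exp_add)
  finally have "exp (- a) * a\<^sup>2 \<le> exp (- a) * exp a" by (intro mult_left_mono) auto
  also have "\<dots> = 1" by (simp flip: exp_add)
  finally have 1: "exp (- a) * a\<^sup>2 \<le> 1" .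
  have "(1 - \<rho>) ^ n * a\<^sup>2 \<le> exp (- a) * a\<^sup>2"
    using power_le_exp[of \<rho> n] assms by (intro mult_right_mono) (auto simp: a_def)
  with 1 have "((1 - \<rho>) ^ n * (real n)\<^sup>2) * \<rho>\<^sup>2 \<le> 1" by (simp add: a_def power_mult_distrib mult_ac)
  thus ?thesis using assms by (simp add: pos_le_divide_eq)
qed

section \<open>From single outcomes to expectations\<close>

locale stochastic_tracking = prob_space M for M :: "'w measure" +
  fixes F :: "nat \<Rightarrow> 'w measure" and f :: "nat \<Rightarrow> 'w \<Rightarrow> 'a::euclidean_space \<Rightarrow> 'a \<Rightarrow> real"
    and reg :: "'w \<Rightarrow> 'a \<Rightarrow> ereal" and xbar x g z :: "nat \<Rightarrow> 'w \<Rightarrow> 'a"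
    and \<mu> L \<gamma> \<mu>hat \<Delta> \<sigma> :: real
  assumes outcome: "\<And>\<omega>. \<omega> \<in> space M \<Longrightarrow>
      decision_dependent \<mu> L \<gamma> \<mu>hat (\<lambda>t. f t \<omega>) (reg \<omega>) (\<lambda>t. xbar t \<omega>)"
    and subalg: "\<And>t. subalgebra M (F t)" and F0: "sets (F 0) = {{}, space M}"
    and x_meas: "\<And>t. x t \<in> borel_measurable (F t)"
    and xbar_meas: "\<And>t. xbar t \<in> borel_measurable (F t)"
    and z_meas: "\<And>t. z t \<in> borel_measurable (F (Suc t))"
    and z_eq: "\<And>t \<omega>. \<omega> \<in> space M \<Longrightarrow> z t \<omega> = grad (f t \<omega> (x t \<omega>)) (x t \<omega>) - g t \<omega>"
    and z_unbiased: "\<And>t. AE \<omega> in M. vec_cond_exp M (F t) (z t) \<omega> = 0"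
    and drift_meas: "\<And>i t. (\<lambda>\<omega>. grad_drift (f i \<omega>) (f t \<omega>)) \<in> borel_measurable M"
    and drift_le: "\<And>i t. i < t \<Longrightarrow> (\<integral>\<^sup>+\<omega>. (grad_drift (f i \<omega>) (f t \<omega>))\<^sup>2 \<partial>M)
        \<le> ennreal ((\<mu>hat * \<Delta> * \<bar>real i - real t\<bar>)\<^sup>2)"
    and z_le: "\<And>i. (\<integral>\<^sup>+\<omega>. ennreal ((norm (z i \<omega>))\<^sup>2) \<partial>M) \<le> ennreal (\<sigma>\<^sup>2)"
    and z_xbar: "\<And>i t. i < t \<Longrightarrow> has_bochner_integral M (\<lambda>\<omega>. z i \<omega> \<bullet> xbar t \<omega>) 0"
begin

abbreviation "rg \<omega> \<equiv> decision_dependent.rgap (\<lambda>t. f t \<omega>) (reg \<omega>) (\<lambda>t. xbar t \<omega>)"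

abbreviation "G i t \<omega> \<equiv> enn2real (grad_drift (f i \<omega>) (f t \<omega>))"

lemma measM [measurable]:
  "x t \<in> borel_measurable M" "xbar t \<in> borel_measurable M" "z t \<in> borel_measurable M"
  using measurable_from_subalg[OF subalg] x_meas xbar_meas z_meas by blast+

text \<open>These deterministic facts live in the locale of one outcome; they are extracted through
  an arbitrary outcome, which a probability space has.\<close>

lemma params: "0 < \<mu>" "0 \<le> \<gamma>" "\<gamma> < \<mu> / 2" "0 < \<mu>hat" "\<mu>hat \<le> \<mu>"
proof -
  obtain \<omega> where \<omega>: "\<omega> \<in> space M" using not_empty by auto
  interpret decision_dependent \<mu> L \<gamma> \<mu>hat "\<lambda>t. f t \<omega>" "reg \<omega>" "\<lambda>t. xbar t \<omega>" by (rule outcome[OF \<omega>])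
  show "0 < \<mu>" "0 \<le> \<gamma>" "\<gamma> < \<mu> / 2" "0 < \<mu>hat" "\<mu>hat \<le> \<mu>"
    by (rule \<mu>_pos \<gamma>_nonneg \<gamma>_less \<mu>hat_pos \<mu>hat_le)+
qed

lemma weight:
  assumes "0 < \<eta>" "L * \<eta> \<le> 1 / 2" "\<rho> = \<mu>hat * \<eta> / (2 - \<mu> * \<eta>)"
  shows "\<mu>hat * \<eta> / 2 \<le> \<rho>" "0 < \<rho>" "\<rho> \<le> 1"
proof -
  obtain \<omega> where \<omega>: "\<omega> \<in> space M" using not_empty by auto
  interpret decision_dependent \<mu> L \<gamma> \<mu>hat "\<lambda>t. f t \<omega>" "reg \<omega>" "\<lambda>t. xbar t \<omega>" by (rule outcome[OF \<omega>])
  show "\<mu>hat * \<eta> / 2 \<le> \<rho>" "0 < \<rho>" "\<rho> \<le> 1" by (rule averaging_weight[OF assms])+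
qed

lemma drift_sq:
  assumes "i \<le> t"
  shows "integrable M (\<lambda>\<omega>. (G i t \<omega>)\<^sup>2)"
    and "(\<integral>\<omega>. (G i t \<omega>)\<^sup>2 \<partial>M) \<le> (\<mu>hat * \<Delta> * real (t - i))\<^sup>2"
    and "AE \<omega> in M. bounded_drift (f i \<omega>) (f t \<omega>) (G i t \<omega>)"
proof -
  have "(\<integral>\<^sup>+\<omega>. (grad_drift (f i \<omega>) (f t \<omega>))\<^sup>2 \<partial>M) \<le> ennreal ((\<mu>hat * \<Delta> * real (t - i))\<^sup>2)"
  proof (cases "i = t")
    case False
    with assms have "\<bar>real i - real t\<bar> = real (t - i)" by simp
    with drift_le[of i t] False assms show ?thesis by simp
  qed (simp add: grad_drift_refl)
  note b = nn_integral_sq_bound[OF drift_meas this]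
  show "integrable M (\<lambda>\<omega>. (G i t \<omega>)\<^sup>2)" "(\<integral>\<omega>. (G i t \<omega>)\<^sup>2 \<partial>M) \<le> (\<mu>hat * \<Delta> * real (t - i))\<^sup>2"
    by (rule b; simp)+
  have "AE \<omega> in M. grad_drift (f i \<omega>) (f t \<omega>) \<noteq> \<infinity>" by (rule b) simp
  thus "AE \<omega> in M. bounded_drift (f i \<omega>) (f t \<omega>) (G i t \<omega>)"
    by eventually_elim (rule grad_drift_finite)
qed

lemma noise_sq:
  shows "integrable M (\<lambda>\<omega>. (norm (z i \<omega>))\<^sup>2)" and "(\<integral>\<omega>. (norm (z i \<omega>))\<^sup>2 \<partial>M) \<le> \<sigma>\<^sup>2"
proof -
  have m: "(\<lambda>\<omega>. ennreal (norm (z i \<omega>))) \<in> borel_measurable M" by measurable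
  have "(\<integral>\<^sup>+\<omega>. (ennreal (norm (z i \<omega>)))\<^sup>2 \<partial>M) \<le> ennreal (\<sigma>\<^sup>2)"
    using z_le[of i] by (simp add: ennreal_power)
  from nn_integral_sq_bound(2,3)[OF m this]
  show "integrable M (\<lambda>\<omega>. (norm (z i \<omega>))\<^sup>2)" "(\<integral>\<omega>. (norm (z i \<omega>))\<^sup>2 \<partial>M) \<le> \<sigma>\<^sup>2" by simp_all
qed

lemma sq_bounded_initial: "sq_bounded M (x 0)" "sq_bounded M (xbar 0)"
proof -
  have sp: "space (F 0) = space M" using subalg[of 0] by (simp add: subalgebra_def)
  show "sq_bounded M (x 0)"
    by (rule trivial_sigma_algebra_constant[OF x_meas F0 sp]) (rule sq_bounded_const)
  show "sq_bounded M (xbar 0)"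
    by (rule trivial_sigma_algebra_constant[OF xbar_meas F0 sp]) (rule sq_bounded_const)
qed

text \<open>\<open>xbar 0\<close> is deterministic, and the drift, which has a second moment,
  controls how far \<open>xbar t\<close> is from it.\<close>

lemma sq_bounded_xbar: "sq_bounded M (xbar t)"
proof -
  have "AE \<omega> in M. (norm (xbar t \<omega> - xbar 0 \<omega>))\<^sup>2 \<le> 1 / (\<mu> - \<gamma>)\<^sup>2 * (G 0 t \<omega>)\<^sup>2"
    using drift_sq(3)[of 0 t, simplified] AE_space
  proof eventually_elim
    case (elim \<omega>)
    interpret decision_dependent \<mu> L \<gamma> \<mu>hat "\<lambda>t. f t \<omega>" "reg \<omega>" "\<lambda>t. xbar t \<omega>" by (rule outcome[OF elim(2)])
    have p: "0 < \<mu> - \<gamma>" using params by simp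
    have "((\<mu> - \<gamma>) * norm (xbar t \<omega> - xbar 0 \<omega>))\<^sup>2 \<le> (G 0 t \<omega>)\<^sup>2"
      using equilibrium_drift[OF elim(1)] p by (intro power_mono) auto
    thus ?case using p unfolding power_mult_distrib by (simp add: pos_le_divide_eq mult.commute)
  qed
  moreover have "mean_bound M (\<lambda>\<omega>. (G 0 t \<omega>)\<^sup>2) ((\<mu>hat * \<Delta> * real (t - 0))\<^sup>2)"
    by (rule mean_bound_integrable; rule drift_sq; simp)
  note mean_bound_scale[OF this, of "1 / (\<mu> - \<gamma>)\<^sup>2"]
  ultimately have "sq_bounded M (\<lambda>\<omega>. xbar t \<omega> - xbar 0 \<omega>)"
    by (intro sq_boundedI) (rule mean_bound_mono, auto)
  from sq_bounded_add[OF this sq_bounded_initial(2)] show ?thesis by simp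
qed

text \<open>The two halves vanish for different reasons: \<open>x i\<close> is known at time
  \<open>i\<close>, whereas \<open>xbar t\<close> may depend on the noise and its orthogonality is
  assumed.\<close>

lemma inner_noise:
  assumes "sq_bounded M (x i)" "i < t"
  shows "has_bochner_integral M (\<lambda>\<omega>. z i \<omega> \<bullet> (x i \<omega> - xbar t \<omega>)) 0"
proof -
  interpret S: finite_measure_subalgebra M "F i"
    by (unfold_locales) (rule subalg)
  have "has_bochner_integral M (\<lambda>\<omega>. z i \<omega> \<bullet> x i \<omega>) 0"
    using assms by (intro S.inner_noise_integral x_meas measM noise_sq z_unbiased sq_bounded_integrable)
  from has_bochner_integral_diff[OF this z_xbar[OF assms(2)]]
  show ?thesis by (simp add: inner_diff_right)
qed

text \<open>Prepares the mean estimate: the noise term can be integrated only once the iterates are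
  square integrable. Distances are taken to the equilibrium of the end time, whose second moment is
  known.\<close>

lemma epoch_sq_bounded:
  assumes \<eta>: "0 < \<eta>" "L * \<eta> \<le> 1 / 2"
    and run: "\<And>\<omega>. \<omega> \<in> space M \<Longrightarrow>
      averaged_prox_run \<mu> \<mu>hat \<eta> s n (\<lambda>_. reg \<omega>) (\<lambda>t. g t \<omega>) (X \<omega>) (\<lambda>j. y j \<omega>) (\<lambda>j. yh j \<omega>)"
    and held: "\<And>j \<omega>. j < n \<Longrightarrow> \<omega> \<in> space M \<Longrightarrow> x (s + j) \<omega> = y j \<omega>"
    and X: "sq_bounded M X" and j: "j \<le> n"
  shows "sq_bounded M (y j) \<and> sq_bounded M (yh j)"
  using j
proof (induction j)
  case 0
  have "sq_bounded M (y 0)" "sq_bounded M (yh 0)"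
    using run by (auto intro!: sq_bounded_cong[OF X] simp: averaged_prox_run_def)
  thus ?case by simp
next
  case (Suc j)
  let ?t = "s + n"
  define C where "C = 1 + 4 / \<mu>hat * (1 + \<eta> + 1 / \<mu>hat)"
  have C: "0 \<le> C" using params \<eta> by (simp add: C_def)
  obtain c where c: "mean_bound M (\<lambda>\<omega>. (norm (y j \<omega> - xbar ?t \<omega>))\<^sup>2) c"
    using sq_bounded_diff[OF _ sq_bounded_xbar, of "y j" ?t] Suc by (auto simp: sq_bounded_def)
  have le: "s + j \<le> ?t" using Suc.prems by simp
  have step: "AE \<omega> in M. (norm (y (Suc j) \<omega> - xbar ?t \<omega>))\<^sup>2
      \<le> C * ((norm (y j \<omega> - xbar ?t \<omega>))\<^sup>2 + (norm (z (s + j) \<omega>))\<^sup>2 + (G (s + j) ?t \<omega>)\<^sup>2)"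
    using drift_sq(3)[OF le] AE_space
  proof eventually_elim
    case (elim \<omega>)
    interpret decision_dependent \<mu> L \<gamma> \<mu>hat "\<lambda>t. f t \<omega>" "reg \<omega>" "\<lambda>t. xbar t \<omega>" by (rule outcome[OF elim(2)])
    have "is_prox \<eta> (reg \<omega>) (y j \<omega> - \<eta> *\<^sub>R g (s + j) \<omega>) (y (Suc j) \<omega>)"
      using run[OF elim(2)] Suc.prems by (simp add: averaged_prox_run_def)
    thus ?case unfolding C_def
      using elim Suc.prems held[of j \<omega>] z_eq[of \<omega> "s + j"]
      by (intro iterate_dist_step[OF _ \<eta>]) auto
  qed
  have "mean_bound M (\<lambda>\<omega>. C * ((norm (y j \<omega> - xbar ?t \<omega>))\<^sup>2 + (norm (z (s + j) \<omega>))\<^sup>2 + (G (s + j) ?t \<omega>)\<^sup>2))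
      (C * (c + \<sigma>\<^sup>2 + (\<mu>hat * \<Delta> * real (?t - (s + j)))\<^sup>2))"
    using Suc.prems
    by (intro mean_bound_scale mean_bound_add c C mean_bound_integrable noise_sq drift_sq) auto
  hence "sq_bounded M (\<lambda>\<omega>. y (Suc j) \<omega> - xbar ?t \<omega>)"
    by (rule sq_boundedI[OF mean_bound_mono[OF _ step order_refl]])
  from sq_bounded_add[OF this sq_bounded_xbar[of ?t]] have y: "sq_bounded M (y (Suc j))" by simp
  define \<rho> where "\<rho> = \<mu>hat * \<eta> / (2 - \<mu> * \<eta>)"
  have "sq_bounded M (\<lambda>\<omega>. (1 - \<rho>) *\<^sub>R yh j \<omega> + \<rho> *\<^sub>R y (Suc j) \<omega>)"
    using y Suc by (intro sq_bounded_add sq_bounded_scaleR) auto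
  moreover have "yh (Suc j) \<omega> = (1 - \<rho>) *\<^sub>R yh j \<omega> + \<rho> *\<^sub>R y (Suc j) \<omega>" if "\<omega> \<in> space M" for \<omega>
    using run[OF that] Suc.prems by (simp add: averaged_prox_run_def \<rho>_def)
  ultimately have "sq_bounded M (yh (Suc j))"
    by (rule sq_bounded_cong)
  with y show ?case by simp
qed

text \<open>The inner products vanish on average and the weights of the noise sum to at most 1. The
  drift contributes 2 from the weighted sum and 12 from the transfer of the starting gap, 14 in
  all.\<close>

lemma epoch_mean:
  assumes \<eta>: "0 < \<eta>" "L * \<eta> \<le> 1 / 2" and \<rho>: "\<rho> = \<mu>hat * \<eta> / (2 - \<mu> * \<eta>)"
    and run: "\<And>\<omega>. \<omega> \<in> space M \<Longrightarrow>
      averaged_prox_run \<mu> \<mu>hat \<eta> s n (\<lambda>_. reg \<omega>) (\<lambda>t. g t \<omega>) (X \<omega>) (\<lambda>j. y j \<omega>) (\<lambda>j. yh j \<omega>)"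
    and held: "\<And>j \<omega>. j < n \<Longrightarrow> \<omega> \<in> space M \<Longrightarrow> x (s + j) \<omega> = y j \<omega>"
    and X: "sq_bounded M X" and fin: "\<And>\<omega>. \<omega> \<in> space M \<Longrightarrow> reg \<omega> (X \<omega>) \<noteq> \<infinity>"
    and e: "mean_bound M (\<lambda>\<omega>. rg \<omega> s (X \<omega>)) e"
  shows "mean_bound M (\<lambda>\<omega>. rg \<omega> (s + n) (yh n \<omega>))
    (3 * (1 - \<rho>) ^ n * e + \<eta> * \<sigma>\<^sup>2 + 14 * \<mu>hat * \<Delta>\<^sup>2 / \<rho>\<^sup>2)"
proof -
  let ?t = "s + n"
  note w = weight[OF \<eta> \<rho>]
  let ?W = "\<lambda>j \<omega>. z (s + j) \<omega> \<bullet> (x (s + j) \<omega> - xbar ?t \<omega>) + \<eta> * (norm (z (s + j) \<omega>))\<^sup>2 + 1 / \<mu>hat * (G (s + j) ?t \<omega>)\<^sup>2"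
  let ?c = "\<lambda>j. 0 + \<eta> * \<sigma>\<^sup>2 + 1 / \<mu>hat * (\<mu>hat * \<Delta> * real (?t - (s + j)))\<^sup>2"
  have "mean_bound M (?W j) (?c j)" if j: "j < n" for j
  proof (intro mean_bound_add mean_bound_scale)
    have "sq_bounded M (y j)" using epoch_sq_bounded[OF \<eta> run held X, of j] j by simp
    hence "sq_bounded M (x (s + j))"
      by (rule sq_bounded_cong) (rule held[OF j])
    from inner_noise[OF this, of ?t] j
    show "mean_bound M (\<lambda>\<omega>. z (s + j) \<omega> \<bullet> (x (s + j) \<omega> - xbar ?t \<omega>)) 0"
      by (intro mean_bound_integrable) (auto simp: has_bochner_integral_iff)
    show "mean_bound M (\<lambda>\<omega>. (norm (z (s + j) \<omega>))\<^sup>2) (\<sigma>\<^sup>2)" by (intro mean_bound_integrable noise_sq)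
    show "mean_bound M (\<lambda>\<omega>. (G (s + j) ?t \<omega>)\<^sup>2) ((\<mu>hat * \<Delta> * real (?t - (s + j)))\<^sup>2)"
      using j by (intro mean_bound_integrable drift_sq) auto
  qed (use \<eta> params in auto)
  hence W: "mean_bound M (\<lambda>\<omega>. \<Sum>j<n. (1 - \<rho>) ^ (n - Suc j) * (\<rho> * ?W j \<omega>))
      (\<Sum>j<n. (1 - \<rho>) ^ (n - Suc j) * (\<rho> * ?c j))"
    using w by (intro mean_bound_sum mean_bound_scale) auto
  have "mean_bound M (\<lambda>\<omega>. (G s ?t \<omega>)\<^sup>2) ((\<mu>hat * \<Delta> * real (?t - s))\<^sup>2)"
    by (intro mean_bound_integrable drift_sq) auto
  hence "mean_bound M (\<lambda>\<omega>. 12 * (1 - \<rho>) ^ n / \<mu> * (G s ?t \<omega>)\<^sup>2) (12 * (1 - \<rho>) ^ n / \<mu> * (\<mu>hat * \<Delta> * real (?t - s))\<^sup>2)"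
    using w params by (intro mean_bound_scale) auto
  note B = mean_bound_add[OF mean_bound_scale[OF e, of "3 * (1 - \<rho>) ^ n"] mean_bound_add[OF this W]]
  have AEd: "AE \<omega> in M. \<forall>j\<in>{..n}. bounded_drift (f (s + j) \<omega>) (f ?t \<omega>) (G (s + j) ?t \<omega>)"
    by (intro AE_finite_allI drift_sq(3)) auto
  show ?thesis
  proof (rule mean_bound_mono[OF B])
    show "0 \<le> 3 * (1 - \<rho>) ^ n" using w by simp
    show "AE \<omega> in M. rg \<omega> ?t (yh n \<omega>) \<le> 3 * (1 - \<rho>) ^ n * rg \<omega> s (X \<omega>)
        + (12 * (1 - \<rho>) ^ n / \<mu> * (G s ?t \<omega>)\<^sup>2 + (\<Sum>j<n. (1 - \<rho>) ^ (n - Suc j) * (\<rho> * ?W j \<omega>)))"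
      using AEd AE_space
    proof eventually_elim
      case (elim \<omega>)
      interpret decision_dependent \<mu> L \<gamma> \<mu>hat "\<lambda>t. f t \<omega>" "reg \<omega>" "\<lambda>t. xbar t \<omega>" by (rule outcome[OF elim(2)])
      have z: "z (s + j) \<omega> = grad (f (s + j) \<omega> (y j \<omega>)) (y j \<omega>) - g (s + j) \<omega>" if "j < n" for j
        using z_eq[OF elim(2), of "s + j"] held[OF that elim(2)] by simp
      have "rgap ?t (yh n \<omega>) \<le> 3 * (1 - \<rho>) ^ n * rgap s (X \<omega>) + (12 * (1 - \<rho>) ^ n / \<mu> * (G (s + 0) ?t \<omega>)\<^sup>2
          + (\<Sum>j<n. (1 - \<rho>) ^ (n - Suc j) * (\<rho> * (z (s + j) \<omega> \<bullet> (y j \<omega> - xbar ?t \<omega>)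
            + \<eta> * (norm (z (s + j) \<omega>))\<^sup>2 + (G (s + j) ?t \<omega>)\<^sup>2 / \<mu>hat))))"
        using elim(1) by (intro epoch_bound[OF run[OF elim(2)] \<eta> \<rho> fin[OF elim(2)] _ z]) auto
      also have "(\<Sum>j<n. (1 - \<rho>) ^ (n - Suc j) * (\<rho> * (z (s + j) \<omega> \<bullet> (y j \<omega> - xbar ?t \<omega>)
            + \<eta> * (norm (z (s + j) \<omega>))\<^sup>2 + (G (s + j) ?t \<omega>)\<^sup>2 / \<mu>hat)))
          = (\<Sum>j<n. (1 - \<rho>) ^ (n - Suc j) * (\<rho> * ?W j \<omega>))"
        using held elim(2) by (intro sum.cong) auto
      finally show ?case by simp
    qed
    have "(\<Sum>j<n. (1 - \<rho>) ^ (n - Suc j) * (\<rho> * ?c j))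
      = \<eta> * \<sigma>\<^sup>2 * (\<rho> * (\<Sum>j<n. (1 - \<rho>) ^ (n - Suc j)))
        + \<mu>hat * \<Delta>\<^sup>2 * (\<rho> * (\<Sum>j<n. (1 - \<rho>) ^ (n - Suc j) * (real (n - j))\<^sup>2))"
      unfolding sum_distrib_left sum.distrib[symmetric] using params
      by (intro sum.cong) (auto simp: field_simps power2_eq_square)
    also have "\<dots> \<le> \<eta> * \<sigma>\<^sup>2 * 1 + \<mu>hat * \<Delta>\<^sup>2 * (2 / \<rho>\<^sup>2)"
      using w \<eta> params
      by (intro add_mono mult_left_mono sum_power_weights_le sum_power_weights_sq_le) auto
    finally have 1: "(\<Sum>j<n. (1 - \<rho>) ^ (n - Suc j) * (\<rho> * ?c j)) \<le> \<eta> * \<sigma>\<^sup>2 + 2 * (\<mu>hat * \<Delta>\<^sup>2 / \<rho>\<^sup>2)"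
      by (simp add: mult.commute)
    have "12 * (1 - \<rho>) ^ n / \<mu> * (\<mu>hat * \<Delta> * real (?t - s))\<^sup>2
        = (\<mu>hat / \<mu>) * (12 * (\<mu>hat * \<Delta>\<^sup>2) * ((1 - \<rho>) ^ n * (real n)\<^sup>2))"
      by (simp add: power2_eq_square mult_ac)
    also have "\<dots> \<le> 1 * (12 * (\<mu>hat * \<Delta>\<^sup>2) * (1 / \<rho>\<^sup>2))"
      using w params by (intro mult_mono mult_left_mono power_mult_sq_le) auto
    finally have 2: "12 * (1 - \<rho>) ^ n / \<mu> * (\<mu>hat * \<Delta> * real (?t - s))\<^sup>2 \<le> 12 * (\<mu>hat * \<Delta>\<^sup>2 / \<rho>\<^sup>2)" by simp
    show "3 * (1 - \<rho>) ^ n * e + (12 * (1 - \<rho>) ^ n / \<mu> * (\<mu>hat * \<Delta> * real (?t - s))\<^sup>2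
        + (\<Sum>j<n. (1 - \<rho>) ^ (n - Suc j) * (\<rho> * ?c j)))
      \<le> 3 * (1 - \<rho>) ^ n * e + \<eta> * \<sigma>\<^sup>2 + 14 * \<mu>hat * \<Delta>\<^sup>2 / \<rho>\<^sup>2"
      using 1 2 by simp
  qed
qed

end

section \<open>The step-decay schedule\<close>

locale epoch_schedule =
  fixes L \<mu>hat \<Delta> \<sigma> D \<eta>star G :: real and \<eta> :: "nat \<Rightarrow> real" and T :: "nat \<Rightarrow> nat" and K :: nat
  assumes pos: "0 < \<mu>hat" "\<mu>hat \<le> L" "0 < \<Delta>" "0 < \<sigma>" "0 < D"
    and ratio: "\<Delta> / \<sigma> < sqrt (\<mu>hat / (16 * L ^ 3))"
    and \<eta>star: "\<eta>star = (2 * \<Delta>\<^sup>2 / (\<mu>hat * \<sigma>\<^sup>2)) powr (1 / 3)"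
    and G: "G = \<mu>hat * (\<Delta> * \<sigma>\<^sup>2 / \<mu>hat\<^sup>2) powr (2 / 3)"
    and K: "K = nat (1 + \<lceil>log 2 (1 / L * (\<sigma>\<^sup>2 * \<mu>hat / \<Delta>\<^sup>2) powr (1 / 3))\<rceil>)"
    and \<eta>0: "\<eta> 0 = 1 / (2 * L)"
    and \<eta>_rec: "\<And>k. k \<ge> 1 \<Longrightarrow> \<eta> k = (\<eta> (k - 1) + \<eta>star) / 2"
    and T0: "T 0 = nat \<lceil>4 * L / \<mu>hat * max (ln (L * D / \<sigma>\<^sup>2)) 0\<rceil>"
    and T_eq: "\<And>k. k \<ge> 1 \<Longrightarrow> T k = nat \<lceil>2 * ln 12 / (\<mu>hat * \<eta> k)\<rceil>"
begin

text \<open>The inverse of \<open>\<eta>star\<close> up to the cube root of 2. It is also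
  \<open>\<sigma>\<^sup>2 / G\<close>, and \<open>2 ^ K\<close> is comparable to
  \<open>\<theta> / L\<close>.\<close>

definition "\<theta> = (\<sigma>\<^sup>2 * \<mu>hat / \<Delta>\<^sup>2) powr (1 / 3)"

lemma L_pos: "0 < L" using pos by simp

lemma powr_third_cubed: "0 < a \<Longrightarrow> (a powr (1 / 3)) ^ 3 = (a :: real)"
  by (simp add: powr_power)

text \<open>The cube roots of the schedule are compared through these powers.\<close>

lemma cubes: "\<theta> ^ 3 = \<sigma>\<^sup>2 * \<mu>hat / \<Delta>\<^sup>2" "\<eta>star ^ 3 = 2 * \<Delta>\<^sup>2 / (\<mu>hat * \<sigma>\<^sup>2)"
    "G ^ 3 = \<Delta>\<^sup>2 * \<sigma> ^ 4 / \<mu>hat"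
proof -
  show "\<theta> ^ 3 = \<sigma>\<^sup>2 * \<mu>hat / \<Delta>\<^sup>2" "\<eta>star ^ 3 = 2 * \<Delta>\<^sup>2 / (\<mu>hat * \<sigma>\<^sup>2)"
    unfolding \<theta>_def \<eta>star using pos by (simp_all add: powr_third_cubed)
  let ?a = "\<Delta> * \<sigma>\<^sup>2 / \<mu>hat\<^sup>2"
  have a: "0 < ?a" using pos by simp
  have "(?a powr (2 / 3)) ^ 3 = ?a powr (2 / 3 * real 3)" using a by (subst powr_power) auto
  also have "\<dots> = ?a powr (real 2)" by simp
  also have "\<dots> = ?a\<^sup>2" using a by (rule powr_realpow)
  finally have "G ^ 3 = \<mu>hat ^ 3 * ?a\<^sup>2" by (simp add: G power_mult_distrib)
  also have "\<dots> = \<Delta>\<^sup>2 * \<sigma> ^ 4 / \<mu>hat"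
    using pos by (simp add: field_simps power2_eq_square power3_eq_cube power4_eq_xxxx)
  finally show "G ^ 3 = \<Delta>\<^sup>2 * \<sigma> ^ 4 / \<mu>hat" .
qed

lemma scale_pos: "0 < \<theta>" "0 < \<eta>star" "0 < G"
  using pos by (simp_all add: \<theta>_def \<eta>star G)

lemma G_\<theta>: "G * \<theta> = \<sigma>\<^sup>2"
proof (rule power_eq_imp_eq_base)
  show "(G * \<theta>) ^ 3 = (\<sigma>\<^sup>2) ^ 3"
    unfolding power_mult_distrib cubes using pos
    by (simp add: field_simps power2_eq_square power3_eq_cube power4_eq_xxxx)
qed (use scale_pos in auto)

text \<open>The product is the cube root of 2, and the cube of \<open>13 / 10\<close> is
  2.197.\<close>

lemma \<eta>star_\<theta>: "1 \<le> \<eta>star * \<theta>" "\<eta>star * \<theta> \<le> 13 / 10"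
proof -
  have c: "(\<eta>star * \<theta>) ^ 3 = 2"
    unfolding power_mult_distrib cubes using pos by simp
  show "1 \<le> \<eta>star * \<theta>"
    by (rule power_le_imp_le_base[of _ 2]) (use c scale_pos in \<open>simp_all add: numeral_3_eq_3[symmetric]\<close>)
  show "\<eta>star * \<theta> \<le> 13 / 10"
    by (rule power_le_imp_le_base[of _ 2]) (simp_all add: numeral_3_eq_3[symmetric] c, simp add: power3_eq_cube)
qed

lemma drift_noise_ratio: "16 * (L ^ 3 * \<Delta>\<^sup>2) < \<sigma>\<^sup>2 * \<mu>hat"
proof -
  have "(\<Delta> / \<sigma>)\<^sup>2 < (sqrt (\<mu>hat / (16 * L ^ 3)))\<^sup>2"
    using ratio pos by (intro power_strict_mono) auto
  also have "\<dots> = \<mu>hat / (16 * L ^ 3)" using pos by simp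
  finally have "\<Delta>\<^sup>2 / \<sigma>\<^sup>2 < \<mu>hat / (16 * L ^ 3)" by (simp add: power_divide)
  thus ?thesis using pos L_pos by (simp add: field_simps)
qed

lemma \<theta>_gt: "2 * L < \<theta>"
proof (rule power_less_imp_less_base)
  have "0 < L ^ 3 * \<Delta>\<^sup>2" using pos L_pos by simp
  hence "8 * (L ^ 3 * \<Delta>\<^sup>2) < \<sigma>\<^sup>2 * \<mu>hat" using drift_noise_ratio by linarith
  thus "(2 * L) ^ 3 < \<theta> ^ 3"
    unfolding cubes power_mult_distrib using pos by (simp add: pos_less_divide_eq)
qed (use scale_pos in simp)

text \<open>The constant 16 in the bound on \<open>\<Delta> / \<sigma>\<close> is tailored to this:
  the cube of \<open>\<eta>star * (2 * L)\<close> is \<open>16 * L ^ 3 * \<Delta>\<^sup>2 /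
  (\<sigma>\<^sup>2 * \<mu>hat)\<close>. As a consequence the step sizes never increase.\<close>

lemma \<eta>star_le: "\<eta>star \<le> \<eta> 0"
proof -
  have "\<eta>star * (2 * L) \<le> 1"
  proof (rule power_le_imp_le_base[of _ 2])
    have "(\<eta>star * (2 * L)) ^ 3 = 16 * (L ^ 3 * \<Delta>\<^sup>2) / (\<sigma>\<^sup>2 * \<mu>hat)"
      unfolding cubes power_mult_distrib by (simp add: mult.commute)
    also have "\<dots> \<le> 1" using drift_noise_ratio pos by simp
    finally show "(\<eta>star * (2 * L)) ^ Suc 2 \<le> 1 ^ Suc 2" by (simp add: numeral_3_eq_3[symmetric])
  qed simp
  thus ?thesis using L_pos by (simp add: \<eta>0 field_simps)
qed

lemma \<eta>_Suc: "\<eta> (Suc k) = (\<eta> k + \<eta>star) / 2"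
  using \<eta>_rec[of "Suc k"] by simp

lemma \<eta>_closed: "\<eta> k = \<eta>star + (\<eta> 0 - \<eta>star) / 2 ^ k"
  by (induction k) (simp_all add: \<eta>_Suc add_divide_distrib)

lemma \<eta>_bounds: "\<eta>star \<le> \<eta> k" "0 < \<eta> k" "L * \<eta> k \<le> 1 / 2"
proof -
  show 1: "\<eta>star \<le> \<eta> k" using \<eta>_closed[of k] \<eta>star_le by simp
  show "0 < \<eta> k" using 1 scale_pos by simp
  have "\<eta> k \<le> \<eta> 0" using \<eta>star_le by (induction k) (simp_all add: \<eta>_Suc)
  hence "L * \<eta> k \<le> L * \<eta> 0" using L_pos by simp
  thus "L * \<eta> k \<le> 1 / 2" using L_pos by (simp add: \<eta>0)
qed

text \<open>The ceiling costs at most a factor 2. As \<open>\<theta> / L > 1\<close>, the logarithm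
  is positive and \<open>nat\<close> truncates nothing.\<close>

lemma K_bounds: "2 * \<theta> / L \<le> 2 ^ K" "2 ^ K \<le> 4 * \<theta> / L" "1 \<le> K"
proof -
  let ?l = "log 2 (\<theta> / L)"
  have t: "1 < \<theta> / L" using \<theta>_gt L_pos by (simp add: field_simps)
  hence l: "0 < ?l" by simp
  have K': "K = nat (1 + \<lceil>?l\<rceil>)" by (simp add: K \<theta>_def)
  have r: "real K = 1 + real_of_int \<lceil>?l\<rceil>" using l unfolding K' by simp
  have "1 + ?l \<le> real K" "real K \<le> 2 + ?l" unfolding r by linarith+
  hence "2 powr (1 + ?l) \<le> 2 powr (real K)" "2 powr (real K) \<le> 2 powr (2 + ?l)" by simp_all
  moreover have "2 powr ?l = \<theta> / L" using t by simp
  moreover have "2 powr (real K) = (2::real) ^ K" by (rule powr_realpow) simp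
  ultimately show "2 * \<theta> / L \<le> 2 ^ K" "2 ^ K \<le> 4 * \<theta> / L" by (simp_all add: powr_add)
  show "1 \<le> K" using l unfolding K' by linarith
qed

text \<open>\<open>\<eta> K\<close> belongs to no epoch; it is the next term of the recursion and
  enters through \<open>err K\<close>. After \<open>K\<close> halvings the initial excess over
  \<open>\<eta>star\<close> is at most \<open>1 / (4 * \<theta>)\<close>.\<close>

lemma \<eta>_final: "\<eta> K \<le> 5 / 4 * \<eta>star"
proof -
  have "(\<eta> 0 - \<eta>star) / 2 ^ K \<le> \<eta> 0 / 2 ^ K"
    using scale_pos by (intro divide_right_mono) auto
  also have "\<dots> \<le> \<eta> 0 / (2 * \<theta> / L)"
    using K_bounds \<eta>_bounds(2)[of 0] scale_pos L_pos by (intro divide_left_mono) auto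
  also have "\<dots> = 1 / (4 * \<theta>)" using L_pos by (simp add: \<eta>0)
  also have "\<dots> \<le> \<eta>star / 4" using \<eta>star_\<theta>(1) scale_pos by (simp add: field_simps)
  finally show ?thesis using \<eta>_closed[of K] by simp
qed

text \<open>Step sizes fall no faster than \<open>\<eta> 0 / 2 ^ k\<close>, so epoch lengths have a
  geometric bound and their sum is governed by \<open>2 ^ K\<close>.\<close>

lemma epoch_length_le: "real (T (Suc k)) \<le> 45 * (L / \<mu>hat) * 2 ^ Suc k"
proof -
  define h where "h = \<eta> (Suc k)"
  have h: "0 < h" "L * h \<le> 1 / 2" unfolding h_def by (rule \<eta>_bounds)+
  have "\<mu>hat * h \<le> L * h" using pos h by (intro mult_right_mono) auto
  with h have "\<mu>hat * h \<le> 1 / 2" by linarith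
  moreover have "0 < \<mu>hat * h" using h pos by simp
  ultimately have m: "0 < \<mu>hat * h" "\<mu>hat * h \<le> 1 / 2" by simp_all
  have ln: "0 \<le> ln (12::real)" "ln (12::real) \<le> 11" using ln_le_minus_one[of 12] by auto
  have "real (T (Suc k)) \<le> 2 * ln 12 / (\<mu>hat * h) + 1"
  proof -
    have "0 \<le> 2 * ln 12 / (\<mu>hat * h)" using m ln by simp
    thus ?thesis using T_eq[of "Suc k"] unfolding h_def by (simp add: of_nat_nat)
  qed
  \<comment> \<open>The crude bound \<open>ln 12 \<le> 11\<close> gives 22; the 1 lost by the
    ceiling is at most \<open>(1 / 2) / (\<mu>hat * h)\<close>.\<close>
  also have "\<dots> \<le> 22 / (\<mu>hat * h) + (1 / 2) / (\<mu>hat * h)"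
    using m ln by (intro add_mono divide_right_mono) (auto simp: field_simps)
  also have "\<dots> = 45 / 2 * (1 / (\<mu>hat * h))" by simp
  also have "1 / (\<mu>hat * h) \<le> 2 * (L / \<mu>hat) * 2 ^ Suc k"
  proof -
    have "\<eta>star / 2 ^ Suc k \<le> \<eta>star / 1"
      using scale_pos one_le_power[of "2::real" "Suc k"] by (intro divide_left_mono) auto
    hence "\<eta> 0 / 2 ^ Suc k \<le> h" unfolding h_def \<eta>_closed[of "Suc k"] diff_divide_distrib by simp
    hence "1 / (2 * L * 2 ^ Suc k) \<le> h" by (simp add: \<eta>0)
    hence "1 / h \<le> 2 * L * 2 ^ Suc k" using h L_pos by (simp add: field_simps)
    hence "1 / h / \<mu>hat \<le> 2 * L * 2 ^ Suc k / \<mu>hat" using pos by (intro divide_right_mono) auto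
    thus ?thesis by (simp add: mult.commute)
  qed
  finally show ?thesis by simp
qed

lemma horizon_le:
  "real (\<Sum>k<K. T k) \<le> 181 * (L / \<mu>hat * max (ln (L * D / \<sigma>\<^sup>2)) 0 + \<sigma>\<^sup>2 / (\<mu>hat * G))"
proof -
  let ?l = "max (ln (L * D / \<sigma>\<^sup>2)) 0"
  obtain K' where K': "K = Suc K'" using K_bounds(3) by (cases K) auto
  have "real (T 0) \<le> 4 * L / \<mu>hat * ?l + 1"
    using pos L_pos unfolding T0 by (simp add: of_nat_nat)
  hence "real (T 0) \<le> 4 * (L / \<mu>hat * ?l) + 1" by simp
  \<comment> \<open>Absorbs the 1 lost by the ceiling in \<open>T 0\<close>, which raises the
    constant from 180 to 181.\<close>
  moreover have "1 \<le> \<theta> / \<mu>hat" using \<theta>_gt pos L_pos by (simp add: field_simps)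
  moreover have "real (\<Sum>k<K'. T (Suc k)) \<le> (\<Sum>k<K'. 45 * (L / \<mu>hat) * 2 ^ Suc k)"
    unfolding of_nat_sum by (intro sum_mono epoch_length_le)
  moreover have "(\<Sum>k<K'. 45 * (L / \<mu>hat) * 2 ^ Suc k) \<le> 180 * (\<theta> / \<mu>hat)"
  proof -
    have "(\<Sum>k<n. (2::real) ^ Suc k) \<le> 2 ^ Suc n" for n by (induction n) auto
    hence "45 * (L / \<mu>hat) * (\<Sum>k<K'. 2 ^ Suc k) \<le> 45 * (L / \<mu>hat) * 2 ^ K"
      using pos L_pos unfolding K' by (intro mult_left_mono) auto
    also have "\<dots> \<le> 45 * (L / \<mu>hat) * (4 * \<theta> / L)"
      using pos L_pos K_bounds by (intro mult_left_mono) auto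
    also have "\<dots> = 180 * (\<theta> / \<mu>hat)" using L_pos by simp
    finally show ?thesis by (simp only: sum_distrib_left)
  qed
  moreover have "real (\<Sum>k<K. T k) = real (T 0) + real (\<Sum>k<K'. T (Suc k))"
    unfolding K' sum.lessThan_Suc_shift by simp
  moreover define a b where "a = L / \<mu>hat * ?l" and "b = \<theta> / \<mu>hat"
  ultimately have "real (\<Sum>k<K. T k) \<le> 4 * a + 181 * b" by simp
  also have "\<dots> \<le> 181 * (a + b)"
  proof -
    have "0 \<le> a" using pos L_pos by (simp add: a_def)
    thus ?thesis by simp
  qed
  also have "b = \<sigma>\<^sup>2 / (\<mu>hat * G)" using scale_pos by (simp add: b_def G_\<theta>[symmetric])
  finally show ?thesis by (simp add: a_def)
qed

lemma log_terms_le: "max (ln (L * D / \<sigma>\<^sup>2)) 0 \<le> max (ln (D / G)) 0"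
proof -
  have "L * D / \<sigma>\<^sup>2 \<le> D / G"
  proof -
    have "L * G \<le> \<theta> * G" using \<theta>_gt L_pos scale_pos by (intro mult_right_mono) auto
    hence "L * G * D \<le> \<sigma>\<^sup>2 * D" using G_\<theta> pos by (intro mult_right_mono) (auto simp: mult.commute)
    thus ?thesis using pos scale_pos by (simp add: field_simps)
  qed
  moreover have "0 < L * D / \<sigma>\<^sup>2" using pos L_pos by simp
  ultimately have "ln (L * D / \<sigma>\<^sup>2) \<le> ln (D / G)" by (simp add: ln_mono)
  thus ?thesis by simp
qed

text \<open>Bound for the expected gap at the start of epoch \<open>k\<close>. Averaging with
  \<open>\<eta>star\<close> turns \<open>14 * \<eta> (Suc k)\<close> into 7 times
  \<open>\<eta> k + \<eta>star\<close>. The 7 in front of \<open>\<eta> k\<close> is spent in the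
  first epoch: 6 on the initial gap, 1 on the noise. The 32 leaves room for the drift:
  \<open>8 + 28 \<le> 32 + 7\<close>.\<close>

definition "err k = (if k = 0 then D else \<sigma>\<^sup>2 * (14 * \<eta> k + 32 * \<eta>star))"

lemma err_step:
  assumes \<rho>: "\<mu>hat * \<eta> k / 2 \<le> \<rho>" "\<rho> \<le> 1"
  shows "3 * (1 - \<rho>) ^ T k * err k + \<eta> k * \<sigma>\<^sup>2 + 14 * \<mu>hat * \<Delta>\<^sup>2 / \<rho>\<^sup>2 \<le> err (Suc k)"
proof -
  define h where "h = \<eta> k"
  have h: "\<eta>star \<le> h" "0 < h" "L * h \<le> 1 / 2" unfolding h_def by (rule \<eta>_bounds)+
  have mh: "0 < \<mu>hat * h / 2" using pos h by simp
  have \<rho>0: "0 < \<rho>" using mh \<rho> by (simp add: h_def)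
  have "14 * \<mu>hat * \<Delta>\<^sup>2 / \<rho>\<^sup>2 \<le> 14 * \<mu>hat * \<Delta>\<^sup>2 / (\<mu>hat * h / 2)\<^sup>2"
    using mh \<rho> \<rho>0 pos unfolding h_def by (intro divide_left_mono power_mono mult_pos_pos zero_less_power) auto
  \<comment> \<open>Writing \<open>\<Delta>\<^sup>2\<close> through the cube of
    \<open>\<eta>star\<close> exhibits the drift as a multiple of \<open>\<eta>star\<close>, damped
    by \<open>(\<eta>star / h)\<^sup>2 \<le> 1\<close>.\<close>
  also have "14 * \<mu>hat * \<Delta>\<^sup>2 / (\<mu>hat * h / 2)\<^sup>2 = 14 * \<mu>hat * (\<eta>star ^ 3 * \<mu>hat * \<sigma>\<^sup>2 / 2) / (\<mu>hat * h / 2)\<^sup>2"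
    unfolding cubes using pos by simp
  also have "\<dots> = 28 * \<sigma>\<^sup>2 * (\<eta>star * (\<eta>star / h)\<^sup>2)"
    using pos h by (simp add: field_simps power2_eq_square power3_eq_cube)
  also have "\<dots> \<le> 28 * \<sigma>\<^sup>2 * (\<eta>star * 1)"
    using h scale_pos by (intro mult_left_mono power_le_one) auto
  finally have drift: "14 * \<mu>hat * \<Delta>\<^sup>2 / \<rho>\<^sup>2 \<le> 28 * \<sigma>\<^sup>2 * \<eta>star" by simp
  have Suc: "err (Suc k) = \<sigma>\<^sup>2 * (7 * h + 39 * \<eta>star)"
    by (simp add: err_def \<eta>_Suc h_def)
  have dec: "(1 - \<rho>) ^ T k \<le> exp (- (\<mu>hat * h / 2 * c))" if "c \<le> real (T k)" "0 \<le> c" for c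
  proof -
    have "(1 - \<rho>) ^ T k \<le> exp (- \<rho> * real (T k))" by (rule power_le_exp) (use \<rho>0 \<rho> in auto)
    also have "\<dots> \<le> exp (- (\<mu>hat * h / 2 * c))"
      using that mult_mono[OF \<rho>(1) that(1)] \<rho>0 by (simp add: h_def)
    finally show ?thesis .
  qed
  have "3 * (1 - \<rho>) ^ T k * err k \<le> \<sigma>\<^sup>2 * (6 * h + 8 * \<eta>star)"
  proof (cases "k = 0")
    case True
    let ?l = "max (ln (L * D / \<sigma>\<^sup>2)) 0"
    have hL: "h = 1 / (2 * L)" by (simp add: h_def True \<eta>0)
    have "4 * L / \<mu>hat * ?l \<le> real (T k)" unfolding True T0 by (rule real_nat_ceiling_ge)
    from dec[OF this] have "(1 - \<rho>) ^ T k \<le> exp (- (\<mu>hat * h / 2 * (4 * L / \<mu>hat * ?l)))"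
      using pos L_pos by simp
    \<comment> \<open>The factor 4 in \<open>T 0\<close> is what makes the exponent exactly the
      positive part of the logarithm, given \<open>h = 1 / (2 * L)\<close>.\<close>
    also have "\<dots> = exp (- ?l)" using pos L_pos by (simp add: hL)
    also have "\<dots> \<le> exp (- ln (L * D / \<sigma>\<^sup>2))" by simp
    also have "\<dots> = \<sigma>\<^sup>2 / (L * D)" using pos L_pos by (simp add: exp_minus field_simps)
    finally have "(1 - \<rho>) ^ T k * D \<le> \<sigma>\<^sup>2 / (L * D) * D" using pos by (intro mult_right_mono) auto
    also have "\<dots> = \<sigma>\<^sup>2 * (2 * h)" using pos L_pos by (simp add: hL)
    finally have "3 * (1 - \<rho>) ^ T k * err k \<le> \<sigma>\<^sup>2 * (6 * h)" by (simp add: err_def True mult_ac)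
    also have "\<dots> \<le> \<sigma>\<^sup>2 * (6 * h + 8 * \<eta>star)" using scale_pos by (intro mult_left_mono) auto
    finally show ?thesis .
  next
    case False
    have "2 * ln 12 / (\<mu>hat * h) \<le> real (T k)"
      using T_eq[of k] False unfolding h_def by (simp add: real_nat_ceiling_ge)
    from dec[OF this] have "(1 - \<rho>) ^ T k \<le> exp (- (\<mu>hat * h / 2 * (2 * ln 12 / (\<mu>hat * h))))"
      using pos h by simp
    also have "\<dots> = exp (- ln 12)" using pos h by simp
    also have "\<dots> = 1 / 12" by (simp add: exp_minus field_simps)
    \<comment> \<open>The 12 in \<open>T k\<close> offsets the loss factor 3 of an epoch and leaves
      a contraction to one quarter.\<close>
    finally have "3 * (1 - \<rho>) ^ T k \<le> 1 / 4" by simp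
    moreover have e: "err k = \<sigma>\<^sup>2 * (14 * h + 32 * \<eta>star)" using False by (simp add: err_def h_def)
    moreover have "0 \<le> err k" using h scale_pos by (simp add: e)
    ultimately have "3 * (1 - \<rho>) ^ T k * err k \<le> 1 / 4 * (\<sigma>\<^sup>2 * (14 * h + 32 * \<eta>star))"
      by (metis mult_right_mono)
    also have "\<dots> \<le> \<sigma>\<^sup>2 * (6 * h + 8 * \<eta>star)" using h by (simp add: algebra_simps)
    finally show ?thesis .
  qed
  with drift have "3 * (1 - \<rho>) ^ T k * err k + h * \<sigma>\<^sup>2 + 14 * \<mu>hat * \<Delta>\<^sup>2 / \<rho>\<^sup>2
      \<le> \<sigma>\<^sup>2 * (7 * h + 36 * \<eta>star)" by (simp add: algebra_simps)
  also have "\<dots> \<le> err (Suc k)" unfolding Suc using scale_pos by (intro mult_left_mono) auto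
  finally show ?thesis by (simp add: h_def)
qed

lemma err_final: "err K \<le> 65 * G"
proof -
  have "err K = \<sigma>\<^sup>2 * (14 * \<eta> K + 32 * \<eta>star)" using K_bounds(3) by (simp add: err_def)
  also have "\<dots> \<le> \<sigma>\<^sup>2 * (50 * \<eta>star)" using \<eta>_final scale_pos by (intro mult_left_mono) auto
  also have "\<dots> = 50 * G * (\<eta>star * \<theta>)" by (simp add: G_\<theta>[symmetric])
  also have "\<dots> \<le> 50 * G * (13 / 10)" using \<eta>star_\<theta> scale_pos by (intro mult_left_mono) auto
  finally show ?thesis by simp
qed

end

section \<open>Transfer of the assumptions and induction over the epochs\<close>

theorem theorem35:
  fixes M :: "'w measure" and F :: "nat \<Rightarrow> 'w measure"
    and f :: "nat \<Rightarrow> 'w \<Rightarrow> 'a::euclidean_space \<Rightarrow> 'a \<Rightarrow> real"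
    and r :: "nat \<Rightarrow> 'w \<Rightarrow> 'a \<Rightarrow> ereal" and reg :: "'w \<Rightarrow> 'a \<Rightarrow> ereal"
    and xbar x g z :: "nat \<Rightarrow> 'w \<Rightarrow> 'a"
    and X :: "nat \<Rightarrow> 'w \<Rightarrow> 'a" and y yh :: "nat \<Rightarrow> nat \<Rightarrow> 'w \<Rightarrow> 'a"
    and \<mu> L \<gamma> \<mu>hat \<Delta> \<sigma> \<eta>star G D :: real and gap0 :: ereal
    and \<eta> :: "nat \<Rightarrow> real" and T s :: "nat \<Rightarrow> nat" and K N :: nat
  (* problem family *)
  assumes "\<mu> > 0" and "L > 0"
    and "\<And>t \<omega> p. \<omega> \<in> space M \<Longrightarrow> strongly_convex \<mu> (f t \<omega> p)"
    and "\<And>t \<omega> p. \<omega> \<in> space M \<Longrightarrow> smooth_fun L (f t \<omega> p)"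
    and "\<And>t \<omega>. \<omega> \<in> space M \<Longrightarrow> proper_closed_convex (r t \<omega>)"
    and "ereal \<gamma> = sensitivity (space M) f" and "\<gamma> < \<mu> / 2"
    and "\<mu>hat = \<mu> - 2 * \<gamma>"
    and "\<And>i t. (\<lambda>\<omega>. grad_drift (f i \<omega>) (f t \<omega>)) \<in> borel_measurable M"
    and "\<And>t \<omega>. \<omega> \<in> space M \<Longrightarrow> is_equilibrium (f t \<omega>) (r t \<omega>) (xbar t \<omega>)"
  (* stochastic framework *)
    and "prob_space M" and "\<And>t. subalgebra M (F t)" and "filtration (space M) F"
    and "sets (F 0) = {{}, space M}"
    and "\<And>t. x t \<in> borel_measurable (F t)" and "\<And>t. xbar t \<in> borel_measurable (F t)"
    and "\<And>t \<omega>. \<omega> \<in> space M \<Longrightarrow> z t \<omega> = grad (f t \<omega> (x t \<omega>)) (x t \<omega>) - g t \<omega>"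
    and "\<And>t. z t \<in> borel_measurable (F (Suc t))" and "\<And>t. integrable M (z t)"
    and "\<And>t. AE \<omega> in M. vec_cond_exp M (F t) (z t) \<omega> = 0"
    and "\<And>\<omega>. \<omega> \<in> space M \<Longrightarrow> gap (f 0 \<omega>) (r 0 \<omega>) (xbar 0 \<omega>) (x 0 \<omega>) = gap0"
  (* hypotheses of the theorem *)
    and "\<And>t. r t = reg"
    and "\<Delta> > 0" and "\<sigma> > 0"
    and "\<And>i t. i < t \<Longrightarrow>
           (\<integral>\<^sup>+\<omega>. (grad_drift (f i \<omega>) (f t \<omega>))\<^sup>2 \<partial>M)
             \<le> ennreal ((\<mu>hat * \<Delta> * \<bar>real i - real t\<bar>)\<^sup>2)"
    and "\<And>i t. i < t \<Longrightarrow> (\<integral>\<^sup>+\<omega>. ennreal ((norm (z i \<omega>))\<^sup>2) \<partial>M) \<le> ennreal (\<sigma>\<^sup>2)"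
    and "\<And>i t. i < t \<Longrightarrow> has_bochner_integral M (\<lambda>\<omega>. z i \<omega> \<bullet> xbar t \<omega>) 0"
    and "\<Delta> / \<sigma> < sqrt (\<mu>hat / (16 * L ^ 3))"
    and "\<eta>star = (2 * \<Delta>\<^sup>2 / (\<mu>hat * \<sigma>\<^sup>2)) powr (1 / 3)"
    and "G = \<mu>hat * (\<Delta> * \<sigma>\<^sup>2 / \<mu>hat\<^sup>2) powr (2 / 3)"
    and "D > 0" and "gap0 \<le> ereal D"
  (* epoch schedule *)
    and "K = nat (1 + \<lceil>log 2 (1 / L * (\<sigma>\<^sup>2 * \<mu>hat / \<Delta>\<^sup>2) powr (1 / 3))\<rceil>)"
    and "\<eta> 0 = 1 / (2 * L)"
    and "\<And>k. k \<ge> 1 \<Longrightarrow> \<eta> k = (\<eta> (k - 1) + \<eta>star) / 2"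
    and "T 0 = nat \<lceil>4 * L / \<mu>hat * max (ln (L * D / \<sigma>\<^sup>2)) 0\<rceil>"
    and "\<And>k. k \<ge> 1 \<Longrightarrow> T k = nat \<lceil>2 * ln 12 / (\<mu>hat * \<eta> k)\<rceil>"
    and "\<And>k. s k = (\<Sum>j<k. T j)" and "N = (\<Sum>k<K. T k)"
  (* the method run in epochs; x (s k + j) is the iterate held at time s k + j *)
    and "\<And>\<omega>. \<omega> \<in> space M \<Longrightarrow> X 0 \<omega> = x 0 \<omega>"
    and "\<And>k \<omega>. k < K \<Longrightarrow> \<omega> \<in> space M \<Longrightarrow>
           averaged_prox_run \<mu> \<mu>hat (\<eta> k) (s k) (T k) (\<lambda>t. r t \<omega>) (\<lambda>t. g t \<omega>)
             (X k \<omega>) (\<lambda>j. y k j \<omega>) (\<lambda>j. yh k j \<omega>)"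
    and "\<And>k j \<omega>. k < K \<Longrightarrow> j < T k \<Longrightarrow> \<omega> \<in> space M \<Longrightarrow> x (s k + j) \<omega> = y k j \<omega>"
    and "\<And>k \<omega>. k < K \<Longrightarrow> \<omega> \<in> space M \<Longrightarrow> X (Suc k) \<omega> = yh k (T k) \<omega>"
  (* the final gap is a random variable *)
    and "(\<lambda>\<omega>. gap (f N \<omega>) (r N \<omega>) (xbar N \<omega>) (X K \<omega>)) \<in> borel_measurable M"
  shows "real N \<le> abs_const * (L / \<mu>hat * max (ln (L * D / \<sigma>\<^sup>2)) 0 + \<sigma>\<^sup>2 / (\<mu>hat * G))
      \<and> L / \<mu>hat * max (ln (L * D / \<sigma>\<^sup>2)) 0 + \<sigma>\<^sup>2 / (\<mu>hat * G)
           \<le> L / \<mu>hat * max (ln (D / G)) 0 + \<sigma>\<^sup>2 / (\<mu>hat * G)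
      \<and> (\<integral>\<^sup>+\<omega>. e2ennreal (gap (f N \<omega>) (r N \<omega>) (xbar N \<omega>) (X K \<omega>)) \<partial>M)
           \<le> ennreal (abs_const * G)"
proof -
  interpret prob_space M by (rule assms(11))
  have sens_le: "ereal (norm (grad (f t \<omega> p) u - grad (f t \<omega> q) u) / norm (p - q)) \<le> ereal \<gamma>"
    if "\<omega> \<in> space M" "p \<noteq> q" for t \<omega> p q u
    unfolding assms(6) sensitivity_def
    by (rule SUP_upper2[of "(\<omega>, t, u, p, q)"]) (use that in auto)
  obtain \<omega>0 where \<omega>0: "\<omega>0 \<in> space M" using not_empty by auto
  obtain b :: 'a where b: "b \<in> Basis" using nonempty_Basis by blast
  have "b \<noteq> 0" using b nonzero_Basis by blast
  \<comment> \<open>The pair \<open>b\<close>, \<open>0\<close> shows that the supremum ranges over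
    a nonempty set of nonnegative quotients.\<close>
  with sens_le[OF \<omega>0, of b 0 0 0] have "ereal 0 \<le> ereal \<gamma>"
    by (meson divide_nonneg_nonneg ereal_less_eq(3) norm_ge_zero order_trans)
  hence \<gamma>0: "0 \<le> \<gamma>" by simp
  have outcome: "decision_dependent \<mu> L \<gamma> \<mu>hat (\<lambda>t. f t \<omega>) (reg \<omega>) (\<lambda>t. xbar t \<omega>)"
    if \<omega>: "\<omega> \<in> space M" for \<omega>
  proof
    show "norm (grad (f t \<omega> p) u - grad (f t \<omega> q) u) \<le> \<gamma> * norm (p - q)" for t p q u
      using sens_le[OF \<omega>, of p q t u] by (cases "p = q") (auto simp: divide_le_eq)
    show "proper_closed_convex (reg \<omega>)" using assms(5)[OF \<omega>, of 0] assms(22) by simp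
    show "is_equilibrium (f t \<omega>) (reg \<omega>) (xbar t \<omega>)" for t using assms(10)[OF \<omega>, of t] assms(22) by simp
  qed (use assms(1,3,4,7,8) \<omega> \<gamma>0 in auto)
  interpret stochastic_tracking M F f reg xbar x g z \<mu> L \<gamma> \<mu>hat \<Delta> \<sigma>
  proof (intro stochastic_tracking.intro stochastic_tracking_axioms.intro)
    \<comment> \<open>The hypothesis speaks of \<open>i < t\<close>; taking \<open>t = Suc i\<close>
      reaches every \<open>i\<close>.\<close>
    show "(\<integral>\<^sup>+\<omega>. ennreal ((norm (z i \<omega>))\<^sup>2) \<partial>M) \<le> ennreal (\<sigma>\<^sup>2)" for i
      using assms(26)[of i "Suc i"] by simp
  qed (rule outcome assms prob_space_axioms | assumption)+
  have "\<mu>hat \<le> L"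
  proof -
    interpret decision_dependent \<mu> L \<gamma> \<mu>hat "\<lambda>t. f t \<omega>0" "reg \<omega>0" "\<lambda>t. xbar t \<omega>0" by (rule outcome[OF \<omega>0])
    show ?thesis using \<mu>hat_le \<mu>_le_L by simp
  qed
  then interpret epoch_schedule L \<mu>hat \<Delta> \<sigma> D \<eta>star G \<eta> T K
    using params assms by unfold_locales auto
  \<comment> \<open>Besides the bound on the mean, the invariant carries finiteness, which makes the
    real gap faithful, and second moments, which let the noise of the next epoch average
    out.\<close>
  have X: "(\<forall>\<omega>\<in>space M. reg \<omega> (X k \<omega>) \<noteq> \<infinity>) \<and> sq_bounded M (X k)
      \<and> mean_bound M (\<lambda>\<omega>. rg \<omega> (s k) (X k \<omega>)) (err k)" if "k \<le> K" for k
    using that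
  proof (induction k)
    case 0
    have "reg \<omega> (X 0 \<omega>) \<noteq> \<infinity> \<and> rg \<omega> 0 (X 0 \<omega>) \<le> D" if \<omega>: "\<omega> \<in> space M" for \<omega>
    proof -
      interpret decision_dependent \<mu> L \<gamma> \<mu>hat "\<lambda>t. f t \<omega>" "reg \<omega>" "\<lambda>t. xbar t \<omega>" by (rule outcome[OF \<omega>])
      have "gap (f 0 \<omega>) (reg \<omega>) (xbar 0 \<omega>) (x 0 \<omega>) \<le> ereal D"
        using assms(21)[OF \<omega>] assms(22,32) by simp
      thus ?thesis unfolding gap_eq assms(40)[OF \<omega>] by (auto split: if_splits)
    qed
    moreover have "sq_bounded M (X 0)" by (rule sq_bounded_cong[OF sq_bounded_initial(1)]) (rule assms(40))
    moreover have "mean_bound M (\<lambda>_. D) D" by (rule mean_bound_integrable) (auto simp: prob_space)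
    ultimately show ?case
      using mean_bound_mono[of M "\<lambda>_. D" D "\<lambda>\<omega>. rg \<omega> 0 (X 0 \<omega>)" D] by (auto simp: err_def assms(38))
  next
    case (Suc k)
    hence k: "k < K" by simp
    note IH = Suc.IH[OF less_imp_le[OF k]]
    have run: "averaged_prox_run \<mu> \<mu>hat (\<eta> k) (s k) (T k) (\<lambda>_. reg \<omega>) (\<lambda>t. g t \<omega>)
        (X k \<omega>) (\<lambda>j. y k j \<omega>) (\<lambda>j. yh k j \<omega>)" if "\<omega> \<in> space M" for \<omega>
      using assms(41)[OF k that] unfolding assms(22) .
    have held: "x (s k + j) \<omega> = y k j \<omega>" if "j < T k" "\<omega> \<in> space M" for j \<omega>
      using assms(42)[OF k that] .
    have last: "X (Suc k) \<omega> = yh k (T k) \<omega>" if "\<omega> \<in> space M" for \<omega> using assms(43)[OF k that] .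
    define \<rho> where "\<rho> = \<mu>hat * \<eta> k / (2 - \<mu> * \<eta> k)"
    note w = weight[OF \<eta>_bounds(2,3) \<rho>_def]
    have "mean_bound M (\<lambda>\<omega>. rg \<omega> (s k + T k) (yh k (T k) \<omega>))
        (3 * (1 - \<rho>) ^ T k * err k + \<eta> k * \<sigma>\<^sup>2 + 14 * \<mu>hat * \<Delta>\<^sup>2 / \<rho>\<^sup>2)"
      using IH by (intro epoch_mean[OF \<eta>_bounds(2,3) \<rho>_def run held]) auto
    from mean_bound_mono[OF this _ err_step[OF w(1,3)], of "\<lambda>\<omega>. rg \<omega> (s (Suc k)) (X (Suc k) \<omega>)"]
    have "mean_bound M (\<lambda>\<omega>. rg \<omega> (s (Suc k)) (X (Suc k) \<omega>)) (err (Suc k))"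
      using last by (auto simp: assms(38))
    moreover have "sq_bounded M (X (Suc k))"
      using epoch_sq_bounded[OF \<eta>_bounds(2,3) run held _ order_refl] IH
      by (intro sq_bounded_cong[OF _ last]) auto
    moreover have "reg \<omega> (X (Suc k) \<omega>) \<noteq> \<infinity>" if \<omega>: "\<omega> \<in> space M" for \<omega>
    proof -
      interpret decision_dependent \<mu> L \<gamma> \<mu>hat "\<lambda>t. f t \<omega>" "reg \<omega>" "\<lambda>t. xbar t \<omega>" by (rule outcome[OF \<omega>])
      show ?thesis
        using averaged_run_finite[OF run[OF \<omega>] \<eta>_bounds(2,3)] IH \<omega> last[OF \<omega>] by simp
    qed
    ultimately show ?case by blast
  qed
  have N: "N = s K" using assms(38,39) by simp
  \<comment> \<open>Nonnegativity matters because \<open>e2ennreal\<close> and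
    \<open>ennreal\<close> cut negative values off at 0, and because it makes the majorant of the
    gap nonnegative.\<close>
  have final: "gap (f N \<omega>) (r N \<omega>) (xbar N \<omega>) (X K \<omega>) = ereal (rg \<omega> N (X K \<omega>)) \<and> 0 \<le> rg \<omega> N (X K \<omega>)"
    if \<omega>: "\<omega> \<in> space M" for \<omega>
  proof -
    interpret decision_dependent \<mu> L \<gamma> \<mu>hat "\<lambda>t. f t \<omega>" "reg \<omega>" "\<lambda>t. xbar t \<omega>" by (rule outcome[OF \<omega>])
    have "reg \<omega> (X K \<omega>) \<noteq> \<infinity>" using X[of K] \<omega> by simp
    thus ?thesis using gap_eq[of N "X K \<omega>"] rgap_nonneg[of "X K \<omega>" N] assms(22) by simp
  qed
  have "(\<integral>\<^sup>+\<omega>. e2ennreal (gap (f N \<omega>) (r N \<omega>) (xbar N \<omega>) (X K \<omega>)) \<partial>M)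
      = (\<integral>\<^sup>+\<omega>. ennreal (rg \<omega> N (X K \<omega>)) \<partial>M)"
    by (intro nn_integral_cong) (use final in \<open>simp add: e2ennreal_ereal\<close>)
  also have "\<dots> \<le> ennreal (err K)"
    using X[of K] final N by (intro mean_bound_nn_integral) auto
  also have "\<dots> \<le> ennreal (abs_const * G)"
    using err_final scale_pos by (intro ennreal_leI) (simp add: abs_const_def)
  finally have error: "(\<integral>\<^sup>+\<omega>. e2ennreal (gap (f N \<omega>) (r N \<omega>) (xbar N \<omega>) (X K \<omega>)) \<partial>M) \<le> ennreal (abs_const * G)" .
  have pos': "0 \<le> L / \<mu>hat * max (ln (L * D / \<sigma>\<^sup>2)) 0 + \<sigma>\<^sup>2 / (\<mu>hat * G)"
    using pos scale_pos L_pos by simp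
  have "real N \<le> abs_const * (L / \<mu>hat * max (ln (L * D / \<sigma>\<^sup>2)) 0 + \<sigma>\<^sup>2 / (\<mu>hat * G))"
    using horizon_le pos' unfolding assms(39) abs_const_def by linarith
  moreover have "L / \<mu>hat * max (ln (L * D / \<sigma>\<^sup>2)) 0 + \<sigma>\<^sup>2 / (\<mu>hat * G)
      \<le> L / \<mu>hat * max (ln (D / G)) 0 + \<sigma>\<^sup>2 / (\<mu>hat * G)"
    using pos L_pos log_terms_le by (intro add_right_mono mult_left_mono) auto
  ultimately show ?thesis using error by blast
qed

end
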